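(* Let $\kappa$ be an infinite cardinal, and let $\mathcal{F}$ and $\mathcal{G}$ be compact and hereditary families on $\kappa$ such that $[\kappa]^1 \subseteq \overline{\mathcal{F}^{MAX}} \cap \overline{\mathcal{G}^{MAX}}$. Then the following are equivalent: (ii) $\mathcal{F}$ and $\mathcal{G}$ are $\pi$-homeomorphic; (iii) $X_{\mathcal{F}}$ and $X_{\mathcal{G}}$ are isometric.
   Context: A family on $\kappa$ is a set $\mathcal{F}$ of finite subsets of $\kappa$ which contains $[\kappa]^{\leq 1}$, i.e. the empty set and all singletons. Here $[\kappa]^n$ is the collection of subsets of $\kappa$ of size $n$. $\mathcal{F}$ is hereditary if it is closed under subsets. Identifying sets with characteristic functions, $\mathcal{F}$ is a subspace of $2^\kappa$ (product topology); $\mathcal{F}$ is compact if it is closed in $2^\kappa$, and the closure $\overline{\,\cdot\,}$ of a family is taken in this topology. $\mathcal{F}^{MAX}$ is the set of elements of $\mathcal{F}$ that are maximal with respect to inclusion. $\mathcal{F}$ and $\mathcal{G}$ are $\pi$-homeomorphic if there is a permutation (bijection) $\pi:\kappa\to\kappa$ such that $\mathcal{G}=\{\pi[s]: s\in\mathcal{F}\}$, where $\pi[s]=\{\pi(\alpha):\alpha\in s\}$. The scalar field $\mathbb{K}$ is $\mathbb{R}$ or $\mathbb{C}$ (the same for both spaces). For a hereditary family $\mathcal{F}$ on $\kappa$, the combinatorial Banach space $X_{\mathcal{F}}$ is the completion of $c_{00}(\kappa)$ (finitely supported functions $\kappa\to\mathbb{K}$) with respect to the norm $\|x\| = \sup\{\sum_{\alpha\in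 s}|x(\alpha)| : s\in\mathcal{F}\}$. Two Banach spaces are isometric if there is a linear bijective norm-preserving operator between them. *)

theory Defs
  imports "HOL-Analysis.Analysis"
begin

text \<open>
  The index set is the type \<^typ>\<open>'a\<close>; a subset \<open>s\<close> is identified with its characteristic
  function \<open>\<lambda>x. x \<in> s\<close>, a point of \<open>'a \<Rightarrow> bool\<close>, on which the class topology is the product
  of discrete topologies.
\<close>

definition char_fun :: "'a set \<Rightarrow> 'a \<Rightarrow> bool" where
  "char_fun s = (\<lambda>x. x \<in> s)"

definition family :: "'a set set \<Rightarrow> bool" where
  "family F \<longleftrightarrow> (\<forall>s\<in>F. finite s) \<and> {} \<in> F \<and> (\<forall>x. {x} \<in> F)"

definition hereditary :: "'a set set \<Rightarrow> bool" where
  "hereditary F \<longleftrightarrow> (\<forall>s\<in>F. \<forall>t. t \<subseteq> s \<longrightarrow> t \<in> F)"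

definition compact_family :: "'a set set \<Rightarrow> bool" where
  "compact_family F \<longleftrightarrow> closed (char_fun ` F)"

definition maximal_sets :: "'a set set \<Rightarrow> 'a set set" where
  "maximal_sets F = {s \<in> F. \<forall>t\<in>F. s \<subseteq> t \<longrightarrow> t = s}"

definition family_closure :: "'a set set \<Rightarrow> 'a set set" where
  "family_closure F = {s. char_fun s \<in> closure (char_fun ` F)}"

definition pi_homeomorphic :: "'a set set \<Rightarrow> 'a set set \<Rightarrow> bool" where
  "pi_homeomorphic F G \<longleftrightarrow> (\<exists>\<pi>. bij \<pi> \<and> G = {\<pi> ` s | s. s \<in> F})"

text \<open>
  The space built from a family depends on the family, a term, so it cannot be a type.
  Normed spaces over a scalar field \<^typ>\<open>'k\<close> are therefore records with an explicit carrier;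
  the operations are only meaningful on the carrier.
\<close>

record ('k, 'v) normed_space =
  points :: "'v set"
  nadd :: "'v \<Rightarrow> 'v \<Rightarrow> 'v"
  nscale :: "'k \<Rightarrow> 'v \<Rightarrow> 'v"
  nnorm :: "'v \<Rightarrow> real"

definition ndist :: "('k::real_normed_field, 'v) normed_space \<Rightarrow> 'v \<Rightarrow> 'v \<Rightarrow> real" where
  "ndist V x y = nnorm V (nadd V x (nscale V (- 1) y))"

text \<open>
  The completion is the space of Cauchy sequences modulo sequences at distance tending to 0.
  Operations on classes are computed on representatives: all members of the unions below
  coincide, and all representatives give the same limit.
\<close>

definition cauchy_seqs :: "('k::real_normed_field, 'v) normed_space \<Rightarrow> (nat \<Rightarrow> 'v) set" where
  "cauchy_seqs V = {u. range u \<subseteq> points V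
                     \<and> (\<forall>e>0. \<exists>N. \<forall>m\<ge>N. \<forall>n\<ge>N. ndist V (u m) (u n) < e)}"

definition cauchy_rel ::
    "('k::real_normed_field, 'v) normed_space \<Rightarrow> ((nat \<Rightarrow> 'v) \<times> (nat \<Rightarrow> 'v)) set" where
  "cauchy_rel V = {(u, v). u \<in> cauchy_seqs V \<and> v \<in> cauchy_seqs V
                     \<and> (\<lambda>n. ndist V (u n) (v n)) \<longlonglongrightarrow> 0}"

definition completion ::
    "('k::real_normed_field, 'v) normed_space \<Rightarrow> ('k, (nat \<Rightarrow> 'v) set) normed_space" where
  "completion V = \<lparr>
     points = cauchy_seqs V // cauchy_rel V,
     nadd = (\<lambda>A B. \<Union>u\<in>A. \<Union>v\<in>B. cauchy_rel V `` {\<lambda>n. nadd V (u n) (v n)}),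
     nscale = (\<lambda>c A. \<Union>u\<in>A. cauchy_rel V `` {\<lambda>n. nscale V c (u n)}),
     nnorm = (\<lambda>A. THE r. \<forall>u\<in>A. (\<lambda>n. nnorm V (u n)) \<longlonglongrightarrow> r) \<rparr>"

definition isometric ::
    "('k::real_normed_field, 'v) normed_space \<Rightarrow> ('k, 'w) normed_space \<Rightarrow> bool" where
  "isometric V W \<longleftrightarrow> (\<exists>T. bij_betw T (points V) (points W)
     \<and> (\<forall>x\<in>points V. \<forall>y\<in>points V. T (nadd V x y) = nadd W (T x) (T y))
     \<and> (\<forall>c. \<forall>x\<in>points V. T (nscale V c x) = nscale W c (T x))
     \<and> (\<forall>x\<in>points V. nnorm W (T x) = nnorm V x))"

definition c00 :: "('a \<Rightarrow> 'k::real_normed_field) set" where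
  "c00 = {x. finite {i. x i \<noteq> 0}}"

text \<open>
  On \<^const>\<open>c00\<close> the set of sums is bounded by the sum of \<open>norm (x i)\<close> over the support of \<open>x\<close>,
  so the real supremum is the intended one.
\<close>

definition family_norm :: "'a set set \<Rightarrow> ('a \<Rightarrow> 'k::real_normed_field) \<Rightarrow> real" where
  "family_norm F x = (SUP s\<in>F. \<Sum>i\<in>s. norm (x i))"

definition c00_space :: "'a set set \<Rightarrow> ('k::real_normed_field, 'a \<Rightarrow> 'k) normed_space" where
  "c00_space F = \<lparr> points = c00, nadd = (\<lambda>x y i. x i + y i), nscale = (\<lambda>c x i. c * x i),
                   nnorm = family_norm F \<rparr>"

definition comb_space ::
    "'k::real_normed_field itself \<Rightarrow> 'a set set \<Rightarrow> ('k, (nat \<Rightarrow> 'a \<Rightarrow> 'k) set) normed_space" where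
  "comb_space K F = completion (c00_space F)"

end

theory Submission
  imports Defs
begin

text \<open>
  A permutation carrying one family to the other clearly induces an isometry. For the converse,
  the aim is to show that an isometry, up to unimodular factors, permutes the coordinates; since
  a finite set \<open>s\<close> belongs to a compact hereditary family exactly when its indicator has norm
  \<open>card s\<close>, that permutation then carries one family to the other.

  Let \<open>T\<close> be the isometry and \<open>T'\<close> its inverse, and consider the matrix of \<open>T'\<close>, whose \<open>i\<close>-th row
  represents the functional \<open>w \<mapsto> (T' w) i\<close>. The heart of the proof is that this row is supported
  on a member of \<open>G\<close> and that its nonzero entries are unimodular. Classically this follows by
  comparing extreme points of the dual unit balls. The argument below stays in the spaces
  themselves. If \<open>s\<close> is maximal in \<open>F\<close>, the norm of \<open>X\<^sub>F\<close> near the indicator of \<open>s\<close> is just the sum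
  over \<open>s\<close>, so the norm is differentiable there. Hence the norm of \<open>X\<^sub>G\<close> is differentiable at
  the image of that indicator. By compactness it is attained there at some \<open>t \<in> G\<close>, and
  differentiating the corresponding sum shows that the derivative is a functional with unimodular
  coefficients on a member of \<open>G\<close> (\<open>smooth_point_functional\<close>). Since \<open>{i}\<close> is a limit of maximal
  sets of \<open>F\<close>, the \<open>i\<close>-th row is a limit of such functionals, and compactness of \<open>G\<close> makes its
  support a member of \<open>G\<close> (\<open>norm_entry\<close>, \<open>row_mem\<close>).

  The same holds for the matrix of \<open>T\<close>. If \<open>l\<close> and \<open>l'\<close> are distinct in the \<open>i\<close>-th row support, then
  \<open>{l, l'} \<in> G\<close>, so no column of the matrix of \<open>T\<close>, being the image of a unit vector, can have
  modulus 1 at both places. As the two matrices are inverse to each other, this forces every row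
  support to be a singleton (\<open>row_singleton\<close>).

  All of this is carried out for functions on the index set: the completion of \<open>c\<^sub>0\<^sub>0\<close> is
  isometric to the space of functions that finitely supported ones approximate in the norm of the
  family (\<open>fun_space_isometric_comb_space\<close>).
\<close>


section \<open>Topology of families\<close>

text \<open>
  Basic neighbourhoods in the product topology constrain only finitely many coordinates, so
  traces on finite sets decide whether a set is in the closure of a family.
\<close>

lemma closure_char_fun_iff:
  "char_fun s \<in> closure (char_fun ` A) \<longleftrightarrow> (\<forall>E. finite E \<longrightarrow> (\<exists>t\<in>A. t \<inter> E = s \<inter> E))"
proof (intro iffI allI impI)
  fix E :: "'a set"
  assume s: "char_fun s \<in> closure (char_fun ` A)" and E: "finite E"
  let ?U = "{f. \<forall>i\<in>E. f i \<in> {char_fun s i}}"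
  have "open ?U"
    using E by (rule product_topology_basis') (simp add: open_discrete)
  moreover have "char_fun s \<in> ?U" by simp
  ultimately have "char_fun ` A \<inter> ?U \<noteq> {}"
    using s[unfolded closure_iff_nhds_not_empty, rule_format, OF subset_refl] by simp
  then obtain t where "t \<in> A" "\<forall>i\<in>E. char_fun t i = char_fun s i"
    by auto
  then show "\<exists>t\<in>A. t \<inter> E = s \<inter> E"
    by (intro bexI[of _ t]) (auto simp: char_fun_def)
next
  assume approx: "\<forall>E. finite E \<longrightarrow> (\<exists>t\<in>A. t \<inter> E = s \<inter> E)"
  show "char_fun s \<in> closure (char_fun ` A)"
    unfolding closure_iff_nhds_not_empty
  proof (intro allI impI)
    fix S U :: "('a \<Rightarrow> bool) set"
    assume "U \<subseteq> S" "open U" "char_fun s \<in> U"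
    then have "openin (product_topology (\<lambda>i. euclidean) UNIV) U" by (simp add: open_fun_def)
    from product_topology_open_contains_basis[OF this \<open>char_fun s \<in> U\<close>]
    obtain X where X: "char_fun s \<in> (\<Pi>\<^sub>E i\<in>UNIV. X i)" "finite {i. X i \<noteq> UNIV}"
      "(\<Pi>\<^sub>E i\<in>UNIV. X i) \<subseteq> U"
      unfolding topspace_euclidean by (elim exE conjE)
    obtain t where t: "t \<in> A" "t \<inter> {i. X i \<noteq> UNIV} = s \<inter> {i. X i \<noteq> UNIV}"
      using approx[rule_format, OF X(2)] by (elim bexE)
    have "char_fun t i \<in> X i" for i
    proof (cases "X i = UNIV")
      case False
      then have "i \<in> t \<longleftrightarrow> i \<in> s"
        using eqset_imp_iff[OF t(2), of i] by simp
      then have "char_fun t i = char_fun s i"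
        by (simp add: char_fun_def)
      moreover have "char_fun s i \<in> X i"
        using X(1) by (simp add: PiE_UNIV_domain Pi_iff)
      ultimately show ?thesis by simp
    qed simp
    then have "char_fun t \<in> U" using X(3) by (simp add: PiE_UNIV_domain subset_eq)
    then have "char_fun t \<in> char_fun ` A \<inter> S" using t(1) \<open>U \<subseteq> S\<close> by (simp add: subset_eq)
    then show "char_fun ` A \<inter> S \<noteq> {}" by (metis empty_iff)
  qed
qed

section \<open>The completion as a space of functions\<close>

text \<open>
  The functions in the norm closure of \<open>c00\<close>. The condition bounds each sum separately rather than
  using \<^const>\<open>family_norm\<close>, because the real supremum is meaningless for a function whose
  sums are unbounded.
\<close>

definition comb_funs :: "'a set set \<Rightarrow> ('a \<Rightarrow> 'k::real_normed_field) set" where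
  "comb_funs F = {f. \<forall>e>0. \<exists>x\<in>c00. \<forall>s\<in>F. (\<Sum>i\<in>s. norm (f i - x i)) \<le> e}"

lemma c00_0 [simp]: "(\<lambda>i. 0) \<in> c00"
  by (simp add: c00_def)

lemma c00_add: "x \<in> c00 \<Longrightarrow> y \<in> c00 \<Longrightarrow> (\<lambda>i. x i + y i) \<in> c00"
  unfolding c00_def by (auto intro: finite_subset [of _ "{i. x i \<noteq> 0} \<union> {i. y i \<noteq> 0}"])

lemma c00_scale: "x \<in> c00 \<Longrightarrow> (\<lambda>i. c * x i) \<in> c00"
  unfolding c00_def by (auto elim!: rev_finite_subset)

lemma c00_indicator [simp]: "finite s \<Longrightarrow> indicator s \<in> c00"
  unfolding c00_def by (auto elim!: rev_finite_subset simp: indicator_def)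

lemma c00_subset_comb_funs: "(c00 :: ('a \<Rightarrow> 'k::real_normed_field) set) \<subseteq> comb_funs F"
proof
  fix x :: "'a \<Rightarrow> 'k" assume "x \<in> c00"
  then show "x \<in> comb_funs F"
    unfolding comb_funs_def by (auto intro!: bexI[of _ x])
qed

lemma c00_imp_comb_funs: "x \<in> c00 \<Longrightarrow> x \<in> comb_funs F"
  by (rule subsetD[OF c00_subset_comb_funs])

lemma indicator_comb_funs [simp]: "finite s \<Longrightarrow> indicator s \<in> comb_funs F"
  by (simp add: c00_imp_comb_funs)

lemma comb_funs_add:
  assumes "f \<in> comb_funs F" "g \<in> comb_funs F"
  shows "(\<lambda>i. f i + g i) \<in> comb_funs F"
  unfolding comb_funs_def
proof (intro CollectI allI impI)
  fix e :: real assume "e > 0"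
  then have "e / 2 > 0" by simp
  then obtain x y where x: "x \<in> c00" "\<forall>s\<in>F. (\<Sum>i\<in>s. norm (f i - x i)) \<le> e / 2"
    and y: "y \<in> c00" "\<forall>s\<in>F. (\<Sum>i\<in>s. norm (g i - y i)) \<le> e / 2"
    using assms unfolding comb_funs_def by blast
  show "\<exists>z\<in>c00. \<forall>s\<in>F. (\<Sum>i\<in>s. norm (f i + g i - z i)) \<le> e"
  proof (intro bexI ballI)
    fix s assume s: "s \<in> F"
    have "(\<Sum>i\<in>s. norm (f i + g i - (x i + y i)))
        \<le> (\<Sum>i\<in>s. norm (f i - x i) + norm (g i - y i))"
      by (intro sum_mono) (simp add: norm_diff_triangle_ineq)
    also have "\<dots> \<le> e / 2 + e / 2"
      unfolding sum.distrib using x(2) y(2) s by (intro add_mono) auto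
    finally show "(\<Sum>i\<in>s. norm (f i + g i - (x i + y i))) \<le> e" by simp
  qed (use x y in \<open>simp add: c00_add\<close>)
qed

lemma comb_funs_scale:
  assumes "f \<in> comb_funs F"
  shows "(\<lambda>i. c * f i) \<in> comb_funs F"
  unfolding comb_funs_def
proof (intro CollectI allI impI)
  fix e :: real assume "e > 0"
  then have "e / (norm c + 1) > 0" by (simp add: add_nonneg_pos)
  then obtain x where x: "x \<in> c00" "\<forall>s\<in>F. (\<Sum>i\<in>s. norm (f i - x i)) \<le> e / (norm c + 1)"
    using assms unfolding comb_funs_def by blast
  show "\<exists>z\<in>c00. \<forall>s\<in>F. (\<Sum>i\<in>s. norm (c * f i - z i)) \<le> e"
  proof (intro bexI ballI)
    fix s assume s: "s \<in> F"
    have "(\<Sum>i\<in>s. norm (c * f i - c * x i)) = norm c * (\<Sum>i\<in>s. norm (f i - x i))"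
      by (simp add: sum_distrib_left norm_mult flip: right_diff_distrib)
    also have "\<dots> \<le> (norm c + 1) * (e / (norm c + 1))"
      using x(2) s by (intro mult_mono) (auto intro: sum_nonneg)
    also have "\<dots> = e" using norm_ge_zero[of c] by (simp add: add_nonneg_eq_0_iff)
    finally show "(\<Sum>i\<in>s. norm (c * f i - c * x i)) \<le> e" .
  qed (use x in \<open>simp add: c00_scale\<close>)
qed

lemma comb_funs_diff:
  assumes "f \<in> comb_funs F" "g \<in> comb_funs F"
  shows "(\<lambda>i. f i - g i) \<in> comb_funs F"
  using comb_funs_add[OF assms(1) comb_funs_scale[OF assms(2), of "-1"]] by simp

lemma comb_funs_sum:
  assumes "\<And>k. k \<in> K \<Longrightarrow> f k \<in> comb_funs F"
  shows "(\<lambda>i. \<Sum>k\<in>K. f k i) \<in> comb_funs F"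
  using assms
proof (induction K rule: infinite_finite_induct)
  case (insert k K)
  then show ?case using comb_funs_add[of "f k" F "\<lambda>i. \<Sum>k\<in>K. f k i"] by simp
qed (use subsetD[OF c00_subset_comb_funs c00_0] in simp_all)

locale set_family =
  fixes F :: "'a set set"
  assumes fam: "family F"
begin

lemma finite_mem: "s \<in> F \<Longrightarrow> finite s"
  using fam by (simp add: family_def)

lemma empty_mem: "{} \<in> F"
  using fam by (simp add: family_def)

lemma singleton_mem: "{i} \<in> F"
  using fam by (simp add: family_def)

text \<open>
  A finitely supported function at distance at most 1 bounds all sums, so on \<^const>\<open>comb_funs\<close>
  the supremum in \<^const>\<open>family_norm\<close> is a genuine least upper bound.
\<close>

lemma sums_bounded:
  assumes "f \<in> comb_funs F"
  shows "bdd_above ((\<lambda>s. \<Sum>i\<in>s. norm (f i)) ` F)"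
proof -
  obtain x where x: "x \<in> c00" "\<forall>s\<in>F. (\<Sum>i\<in>s. norm (f i - x i)) \<le> 1"
    using assms unfolding comb_funs_def by (auto dest: spec[of _ 1])
  let ?S = "{i. x i \<noteq> 0}"
  have fin: "finite ?S" using x(1) by (simp add: c00_def)
  have "(\<Sum>i\<in>s. norm (f i)) \<le> 1 + (\<Sum>i\<in>?S. norm (x i))" if s: "s \<in> F" for s
  proof -
    have "(\<Sum>i\<in>s. norm (f i)) \<le> (\<Sum>i\<in>s. norm (f i - x i) + norm (x i))"
      by (intro sum_mono) (metis norm_triangle_sub add.commute)
    also have "\<dots> \<le> 1 + (\<Sum>i\<in>s. norm (x i))"
      unfolding sum.distrib using x(2) s by simp
    also have "(\<Sum>i\<in>s. norm (x i)) = (\<Sum>i\<in>s \<inter> ?S. norm (x i))"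
      using finite_mem[OF s] by (intro sum.mono_neutral_right) auto
    also have "\<dots> \<le> (\<Sum>i\<in>?S. norm (x i))"
      using fin by (intro sum_mono2) auto
    finally show ?thesis by simp
  qed
  then show ?thesis by (intro bdd_aboveI2)
qed

lemma sum_le_family_norm:
  "f \<in> comb_funs F \<Longrightarrow> s \<in> F \<Longrightarrow> (\<Sum>i\<in>s. norm (f i)) \<le> family_norm F f"
  unfolding family_norm_def by (rule cSUP_upper[OF _ sums_bounded])

lemma family_norm_le:
  "(\<And>s. s \<in> F \<Longrightarrow> (\<Sum>i\<in>s. norm (f i)) \<le> B) \<Longrightarrow> family_norm F f \<le> B"
  unfolding family_norm_def using empty_mem by (intro cSUP_least) auto

lemma norm_coord_le: "f \<in> comb_funs F \<Longrightarrow> norm (f i) \<le> family_norm F f"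
  using sum_le_family_norm[OF _ singleton_mem] by simp

lemma family_norm_nonneg: "f \<in> comb_funs F \<Longrightarrow> 0 \<le> family_norm F f"
  using sum_le_family_norm[OF _ empty_mem] by simp

lemma family_norm_triangle:
  assumes "f \<in> comb_funs F" "g \<in> comb_funs F"
  shows "family_norm F (\<lambda>i. f i + g i) \<le> family_norm F f + family_norm F g"
proof (rule family_norm_le)
  fix s assume s: "s \<in> F"
  have "(\<Sum>i\<in>s. norm (f i + g i)) \<le> (\<Sum>i\<in>s. norm (f i) + norm (g i))"
    by (intro sum_mono norm_triangle_ineq)
  also have "\<dots> \<le> family_norm F f + family_norm F g"
    unfolding sum.distrib by (intro add_mono sum_le_family_norm assms s)
  finally show "(\<Sum>i\<in>s. norm (f i + g i)) \<le> family_norm F f + family_norm F g" .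
qed

lemma family_norm_scale_le:
  assumes "f \<in> comb_funs F"
  shows "family_norm F (\<lambda>i. c * f i) \<le> norm c * family_norm F f"
proof (rule family_norm_le)
  fix s assume s: "s \<in> F"
  have "(\<Sum>i\<in>s. norm (c * f i)) = norm c * (\<Sum>i\<in>s. norm (f i))"
    by (simp add: sum_distrib_left norm_mult)
  also have "\<dots> \<le> norm c * family_norm F f"
    by (intro mult_left_mono sum_le_family_norm assms s) simp
  finally show "(\<Sum>i\<in>s. norm (c * f i)) \<le> norm c * family_norm F f" .
qed

lemma family_norm_minus_commute:
  "family_norm F (\<lambda>i. f i - g i) = family_norm F (\<lambda>i. g i - f i)"
  unfolding family_norm_def by (simp add: norm_minus_commute)

lemma family_norm_diff_triangle:
  assumes "f \<in> comb_funs F" "g \<in> comb_funs F" "h \<in> comb_funs F"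
  shows "family_norm F (\<lambda>i. f i - h i)
       \<le> family_norm F (\<lambda>i. f i - g i) + family_norm F (\<lambda>i. g i - h i)"
  using family_norm_triangle[OF comb_funs_diff[OF assms(1,2)] comb_funs_diff[OF assms(2,3)]]
  by simp

lemma c00_dense:
  assumes "f \<in> comb_funs F" "e > 0"
  obtains x where "x \<in> c00" "family_norm F (\<lambda>i. f i - x i) \<le> e"
proof -
  obtain x where "x \<in> c00" "\<forall>s\<in>F. (\<Sum>i\<in>s. norm (f i - x i)) \<le> e"
    using assms unfolding comb_funs_def by blast
  then show thesis by (intro that family_norm_le) auto
qed

lemma norm_indicator_singleton: "family_norm F (indicator {i} :: 'a \<Rightarrow> 'k::real_normed_field) = 1"
proof (rule antisym)
  show "family_norm F (indicator {i} :: 'a \<Rightarrow> 'k) \<le> 1"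
  proof (rule family_norm_le)
    fix s assume "s \<in> F"
    have "(\<Sum>j\<in>s. norm (indicator {i} j :: 'k)) = (\<Sum>j\<in>s. if j = i then 1 else 0)"
      by (intro sum.cong) (auto simp: indicator_def)
    then show "(\<Sum>j\<in>s. norm (indicator {i} j :: 'k)) \<le> 1"
      using finite_mem[OF \<open>s \<in> F\<close>] by simp
  qed
  show "1 \<le> family_norm F (indicator {i} :: 'a \<Rightarrow> 'k)"
    using norm_coord_le[of "indicator {i} :: 'a \<Rightarrow> 'k" i] by simp
qed

text \<open>
  A point of the completion is a class of Cauchy sequences. It is identified with the common limit
  function of its members; the next lemmas show that the classes are exactly the sets of sequences
  with a given limit.
\<close>

definition converges :: "(nat \<Rightarrow> 'a \<Rightarrow> 'k::real_normed_field) \<Rightarrow> ('a \<Rightarrow> 'k) \<Rightarrow> bool" where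
  "converges u f \<longleftrightarrow> range u \<subseteq> c00 \<and> f \<in> comb_funs F
     \<and> (\<lambda>n. family_norm F (\<lambda>i. u n i - f i)) \<longlonglongrightarrow> 0"

lemma ndist_c00_space: "ndist (c00_space F) x y = family_norm F (\<lambda>i. x i - y i)"
  by (simp add: ndist_def c00_space_def)

lemma converges_c00: "converges u f \<Longrightarrow> u n \<in> c00"
  by (auto simp: converges_def)

lemma converges_mem: "converges u f \<Longrightarrow> u n \<in> comb_funs F"
  by (simp add: c00_imp_comb_funs converges_c00)

lemma converges_limit_mem: "converges u f \<Longrightarrow> f \<in> comb_funs F"
  by (simp add: converges_def)

lemma converges_null: "converges u f \<Longrightarrow> (\<lambda>n. family_norm F (\<lambda>i. u n i - f i)) \<longlonglongrightarrow> 0"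
  by (simp add: converges_def)

lemma converges_unique:
  assumes "converges u f" "converges u g"
  shows "f = g"
proof
  fix i
  have "(\<lambda>n. u n i) \<longlonglongrightarrow> h i" if "converges u h" for h
  proof -
    have "norm (u n i - h i) \<le> family_norm F (\<lambda>i. u n i - h i)" for n
      using norm_coord_le[OF comb_funs_diff, OF converges_mem[OF that] converges_limit_mem[OF that]] .
    then have "(\<lambda>n. u n i - h i) \<longlonglongrightarrow> 0"
      by (intro Lim_null_comparison[OF always_eventually converges_null[OF that]]) auto
    then show ?thesis by (simp add: LIM_zero_iff)
  qed
  then show "f i = g i" using assms LIMSEQ_unique by blast
qed

lemma converges_exists:
  assumes "f \<in> comb_funs F"
  shows "\<exists>u. converges u f"
proof -
  have "\<exists>x\<in>c00. family_norm F (\<lambda>i. f i - x i) \<le> inverse (real (Suc n))" for n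
    by (rule c00_dense[OF assms, of "inverse (real (Suc n))"]) auto
  then obtain u where u: "\<And>n. u n \<in> c00"
      "\<And>n. family_norm F (\<lambda>i. f i - u n i) \<le> inverse (real (Suc n))"
    by metis
  have "(\<lambda>n. family_norm F (\<lambda>i. u n i - f i)) \<longlonglongrightarrow> 0"
  proof (rule tendsto_sandwich[OF _ _ tendsto_const LIMSEQ_inverse_real_of_nat])
    show "\<forall>\<^sub>F n in sequentially. 0 \<le> family_norm F (\<lambda>i. u n i - f i)"
      using u(1) assms
      by (intro always_eventually allI family_norm_nonneg comb_funs_diff) (auto intro: c00_imp_comb_funs)
  qed (use u(2) in \<open>simp add: family_norm_minus_commute\<close>)
  then show ?thesis using u(1) assms unfolding converges_def by blast
qed

lemma converges_imp_cauchy: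
  assumes "converges u f"
  shows "u \<in> cauchy_seqs (c00_space F)"
  unfolding cauchy_seqs_def ndist_c00_space
proof (intro CollectI conjI allI impI)
  show "range u \<subseteq> points (c00_space F)"
    using assms by (simp add: converges_def c00_space_def)
  note u = converges_mem[OF assms] and f = converges_limit_mem[OF assms]
  fix e :: real assume "e > 0"
  then have "\<forall>\<^sub>F n in sequentially. family_norm F (\<lambda>i. u n i - f i) < e / 2"
    using converges_null[OF assms] by (intro order_tendstoD(2)[of _ 0]) auto
  then obtain N where N: "\<And>n. n \<ge> N \<Longrightarrow> family_norm F (\<lambda>i. u n i - f i) < e / 2"
    unfolding eventually_sequentially by blast
  have "family_norm F (\<lambda>i. u m i - u n i) < e" if "m \<ge> N" "n \<ge> N" for m n
    using family_norm_diff_triangle[OF u f u, of m n] N[OF that(1)] N[OF that(2)]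
      family_norm_minus_commute[of "u n" f] by linarith
  then show "\<exists>N. \<forall>m\<ge>N. \<forall>n\<ge>N. family_norm F (\<lambda>i. u m i - u n i) < e" by blast
qed

text \<open>
  The limit is taken coordinatewise, which is possible because evaluations are bounded by the norm.
  Each single sum is finite, so the uniform Cauchy estimate passes to the limit in every sum.
\<close>

lemma cauchy_imp_converges:
  fixes u :: "nat \<Rightarrow> 'a \<Rightarrow> 'k::{real_normed_field,banach}"
  assumes "u \<in> cauchy_seqs (c00_space F)"
  shows "\<exists>f. converges u f"
proof -
  have c00: "range u \<subseteq> c00"
    using assms by (simp add: cauchy_seqs_def c00_space_def)
  then have u: "u n \<in> comb_funs F" for n
    by (auto intro: c00_imp_comb_funs)
  have cauchy: "\<exists>N. \<forall>m\<ge>N. \<forall>n\<ge>N. family_norm F (\<lambda>i. u m i - u n i) < e" if "e > 0" for e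
    using assms that unfolding cauchy_seqs_def ndist_c00_space by blast
  have "Cauchy (\<lambda>n. u n i)" for i
  proof (rule CauchyI)
    fix e :: real assume "e > 0"
    then obtain N where N: "\<And>m n. m \<ge> N \<Longrightarrow> n \<ge> N \<Longrightarrow> family_norm F (\<lambda>i. u m i - u n i) < e"
      using cauchy by blast
    show "\<exists>N. \<forall>m\<ge>N. \<forall>n\<ge>N. norm (u m i - u n i) < e"
    proof (intro exI allI impI)
      fix m n assume "m \<ge> N" "n \<ge> N"
      then show "norm (u m i - u n i) < e"
        by (rule le_less_trans[OF norm_coord_le[OF comb_funs_diff[OF u u]] N])
    qed
  qed
  then obtain f where f: "\<And>i. (\<lambda>n. u n i) \<longlonglongrightarrow> f i"
    unfolding Cauchy_convergent_iff convergent_def by metis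
  have close: "\<exists>N. \<forall>n\<ge>N. \<forall>s\<in>F. (\<Sum>i\<in>s. norm (f i - u n i)) \<le> e" if e: "e > 0" for e
  proof -
    obtain N where N: "\<And>m n. m \<ge> N \<Longrightarrow> n \<ge> N \<Longrightarrow> family_norm F (\<lambda>i. u m i - u n i) < e"
      using cauchy[OF e] by blast
    have "(\<Sum>i\<in>s. norm (f i - u n i)) \<le> e" if "n \<ge> N" "s \<in> F" for n s
    proof (rule tendsto_upperbound)
      show "(\<lambda>m. \<Sum>i\<in>s. norm (u m i - u n i)) \<longlonglongrightarrow> (\<Sum>i\<in>s. norm (f i - u n i))"
        by (intro tendsto_intros f)
      have "(\<Sum>i\<in>s. norm (u m i - u n i)) \<le> e" if "m \<ge> N" for m
        using sum_le_family_norm[OF comb_funs_diff[OF u[of m] u[of n]] \<open>s \<in> F\<close>]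
          N[OF that \<open>n \<ge> N\<close>] by linarith
      then show "\<forall>\<^sub>F m in sequentially. (\<Sum>i\<in>s. norm (u m i - u n i)) \<le> e"
        by (auto simp: eventually_sequentially)
    qed simp
    then show ?thesis by blast
  qed
  have "f \<in> comb_funs F"
    unfolding comb_funs_def
  proof (intro CollectI allI impI)
    fix e :: real assume "e > 0"
    then obtain N where "\<forall>n\<ge>N. \<forall>s\<in>F. (\<Sum>i\<in>s. norm (f i - u n i)) \<le> e"
      using close by blast
    then show "\<exists>x\<in>c00. \<forall>s\<in>F. (\<Sum>i\<in>s. norm (f i - x i)) \<le> e"
      using c00 by (intro bexI[of _ "u N"]) auto
  qed
  moreover have "(\<lambda>n. family_norm F (\<lambda>i. u n i - f i)) \<longlonglongrightarrow> 0"
  proof (rule LIMSEQ_I)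
    fix e :: real assume e: "e > 0"
    then obtain N where "\<forall>n\<ge>N. \<forall>s\<in>F. (\<Sum>i\<in>s. norm (f i - u n i)) \<le> e / 2"
      using close[of "e / 2"] by auto
    then have "\<forall>n\<ge>N. family_norm F (\<lambda>i. u n i - f i) \<le> e / 2"
      unfolding family_norm_minus_commute[of _ f] by (intro allI impI family_norm_le) simp
    moreover have "0 \<le> family_norm F (\<lambda>i. u n i - f i)" for n
      using family_norm_nonneg[OF comb_funs_diff[OF u \<open>f \<in> comb_funs F\<close>]] .
    ultimately show "\<exists>N. \<forall>n\<ge>N. norm (family_norm F (\<lambda>i. u n i - f i) - 0) < e"
      using e by (intro exI[of _ N]) (auto intro: le_less_trans)
  qed
  ultimately show ?thesis using c00 unfolding converges_def by blast
qed

lemma cauchy_rel_iff_same_limit: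
  fixes u v :: "nat \<Rightarrow> 'a \<Rightarrow> 'k::{real_normed_field,banach}"
  assumes u: "converges u f"
  shows "(u, v) \<in> cauchy_rel (c00_space F) \<longleftrightarrow> converges v f"
proof -
  note fin = converges_limit_mem[OF u] and uin = converges_mem[OF u] and uf = converges_null[OF u]
  show ?thesis
  proof
    assume "converges v f"
    note vin = converges_mem[OF this] and vf = converges_null[OF this]
    have "(\<lambda>n. family_norm F (\<lambda>i. u n i - v n i)) \<longlonglongrightarrow> 0"
    proof (rule tendsto_sandwich[OF _ _ tendsto_const])
      show "(\<lambda>n. family_norm F (\<lambda>i. u n i - f i) + family_norm F (\<lambda>i. v n i - f i)) \<longlonglongrightarrow> 0"
        using tendsto_add[OF uf vf] by simp
      show "\<forall>\<^sub>F n in sequentially. 0 \<le> family_norm F (\<lambda>i. u n i - v n i)"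
        by (intro always_eventually allI family_norm_nonneg comb_funs_diff uin vin)
      show "\<forall>\<^sub>F n in sequentially. family_norm F (\<lambda>i. u n i - v n i)
          \<le> family_norm F (\<lambda>i. u n i - f i) + family_norm F (\<lambda>i. v n i - f i)"
      proof (intro always_eventually allI)
        show "family_norm F (\<lambda>i. u n i - v n i)
            \<le> family_norm F (\<lambda>i. u n i - f i) + family_norm F (\<lambda>i. v n i - f i)" for n
          using family_norm_diff_triangle[OF uin fin vin, of n n]
          unfolding family_norm_minus_commute[of f "v n"] .
      qed
    qed
    then show "(u, v) \<in> cauchy_rel (c00_space F)"
      using converges_imp_cauchy[OF u] converges_imp_cauchy[OF \<open>converges v f\<close>]
      by (simp add: cauchy_rel_def ndist_c00_space)
  next
    assume rel: "(u, v) \<in> cauchy_rel (c00_space F)"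
    then have v00: "range v \<subseteq> c00"
      by (simp add: cauchy_rel_def cauchy_seqs_def c00_space_def)
    then have vin: "v n \<in> comb_funs F" for n by (auto intro: c00_imp_comb_funs)
    have uv: "(\<lambda>n. family_norm F (\<lambda>i. u n i - v n i)) \<longlonglongrightarrow> 0"
      using rel by (simp add: cauchy_rel_def ndist_c00_space)
    have "(\<lambda>n. family_norm F (\<lambda>i. v n i - f i)) \<longlonglongrightarrow> 0"
    proof (rule tendsto_sandwich[OF _ _ tendsto_const])
      show "(\<lambda>n. family_norm F (\<lambda>i. u n i - v n i) + family_norm F (\<lambda>i. u n i - f i)) \<longlonglongrightarrow> 0"
        using tendsto_add[OF uv uf] by simp
      show "\<forall>\<^sub>F n in sequentially. 0 \<le> family_norm F (\<lambda>i. v n i - f i)"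
        by (intro always_eventually allI family_norm_nonneg comb_funs_diff fin vin)
      show "\<forall>\<^sub>F n in sequentially. family_norm F (\<lambda>i. v n i - f i)
          \<le> family_norm F (\<lambda>i. u n i - v n i) + family_norm F (\<lambda>i. u n i - f i)"
      proof (intro always_eventually allI)
        show "family_norm F (\<lambda>i. v n i - f i)
            \<le> family_norm F (\<lambda>i. u n i - v n i) + family_norm F (\<lambda>i. u n i - f i)" for n
          using family_norm_diff_triangle[OF vin uin fin, of n n]
          unfolding family_norm_minus_commute[of "v n" "u n"] .
      qed
    qed
    then show "converges v f" using v00 fin by (simp add: converges_def)
  qed
qed

lemma converges_add:
  assumes "converges u f" "converges v g"
  shows "converges (\<lambda>n i. u n i + v n i) (\<lambda>i. f i + g i)"
proof -
  note fg = converges_limit_mem[OF assms(1)] converges_limit_mem[OF assms(2)]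
    and uv = converges_mem[OF assms(1)] converges_mem[OF assms(2)]
  have "(\<lambda>n. family_norm F (\<lambda>i. (u n i + v n i) - (f i + g i))) \<longlonglongrightarrow> 0"
  proof (rule tendsto_sandwich[OF _ _ tendsto_const])
    show "(\<lambda>n. family_norm F (\<lambda>i. u n i - f i) + family_norm F (\<lambda>i. v n i - g i)) \<longlonglongrightarrow> 0"
      by (intro tendsto_add_zero converges_null assms)
    show "\<forall>\<^sub>F n in sequentially. 0 \<le> family_norm F (\<lambda>i. (u n i + v n i) - (f i + g i))"
      by (intro always_eventually allI family_norm_nonneg comb_funs_diff comb_funs_add fg uv)
    show "\<forall>\<^sub>F n in sequentially. family_norm F (\<lambda>i. (u n i + v n i) - (f i + g i))
        \<le> family_norm F (\<lambda>i. u n i - f i) + family_norm F (\<lambda>i. v n i - g i)"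
      using family_norm_triangle[OF comb_funs_diff[OF uv(1) fg(1)] comb_funs_diff[OF uv(2) fg(2)]]
      by (intro always_eventually allI) (simp add: add_diff_add)
  qed
  then show ?thesis
    using assms unfolding converges_def by (auto intro: c00_add comb_funs_add)
qed

lemma converges_scale:
  assumes "converges u f"
  shows "converges (\<lambda>n i. c * u n i) (\<lambda>i. c * f i)"
proof -
  note f = converges_limit_mem[OF assms] and u = converges_mem[OF assms]
  have "(\<lambda>n. family_norm F (\<lambda>i. c * u n i - c * f i)) \<longlonglongrightarrow> 0"
  proof (rule tendsto_sandwich[OF _ _ tendsto_const])
    show "(\<lambda>n. norm c * family_norm F (\<lambda>i. u n i - f i)) \<longlonglongrightarrow> 0"
      by (intro tendsto_mult_right_zero converges_null assms)
    show "\<forall>\<^sub>F n in sequentially. 0 \<le> family_norm F (\<lambda>i. c * u n i - c * f i)"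
      by (intro always_eventually allI family_norm_nonneg comb_funs_diff comb_funs_scale f u)
    show "\<forall>\<^sub>F n in sequentially. family_norm F (\<lambda>i. c * u n i - c * f i)
        \<le> norm c * family_norm F (\<lambda>i. u n i - f i)"
      using family_norm_scale_le[OF comb_funs_diff[OF u f], of c]
      by (intro always_eventually allI) (simp add: right_diff_distrib)
  qed
  then show ?thesis
    using assms unfolding converges_def by (auto intro: c00_scale comb_funs_scale)
qed

lemma converges_norm:
  assumes "converges u f"
  shows "(\<lambda>n. family_norm F (u n)) \<longlonglongrightarrow> family_norm F f"
proof -
  note f = converges_limit_mem[OF assms] and u = converges_mem[OF assms]
  have "\<bar>family_norm F (u n) - family_norm F f\<bar> \<le> family_norm F (\<lambda>i. u n i - f i)" for n
    using family_norm_triangle[OF comb_funs_diff[OF u f] f, of n]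
      family_norm_triangle[OF comb_funs_diff[OF f u] u, of n n]
      family_norm_minus_commute[of f "u n"] by simp
  then have "(\<lambda>n. family_norm F (u n) - family_norm F f) \<longlonglongrightarrow> 0"
    by (intro Lim_null_comparison[OF always_eventually converges_null[OF assms]]) auto
  then show ?thesis by (simp add: LIM_zero_iff)
qed

end

definition fun_space :: "'a set set \<Rightarrow> ('k::real_normed_field, 'a \<Rightarrow> 'k) normed_space" where
  "fun_space F = \<lparr> points = comb_funs F, nadd = (\<lambda>x y i. x i + y i),
                   nscale = (\<lambda>c x i. c * x i), nnorm = family_norm F \<rparr>"

text \<open>
  The isometry sends a function to the class of all sequences converging to it. The unions in the
  definition of the operations range over representatives that all give the same class, and the
  definite description of the norm is fixed by continuity of the norm.
\<close>

lemma (in set_family) fun_space_isometric_comb_space: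
  "isometric (fun_space F) (comb_space TYPE('k::{real_normed_field,banach}) F)"
proof -
  define E :: "('a \<Rightarrow> 'k) \<Rightarrow> (nat \<Rightarrow> 'a \<Rightarrow> 'k) set" where "E f = {u. converges u f}" for f
  have cls: "cauchy_rel (c00_space F) `` {u} = E f" if "converges u f" for u f
    using cauchy_rel_iff_same_limit[OF that] by (auto simp: E_def)
  have points: "points (comb_space TYPE('k) F) = E ` comb_funs F"
  proof (intro equalityI subsetI)
    fix A :: "(nat \<Rightarrow> 'a \<Rightarrow> 'k) set" assume "A \<in> points (comb_space TYPE('k) F)"
    then obtain u where u: "u \<in> cauchy_seqs (c00_space F)" "A = cauchy_rel (c00_space F) `` {u}"
      by (auto simp: comb_space_def completion_def quotient_def)
    then obtain f where "converges u f" using cauchy_imp_converges by blast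
    then show "A \<in> E ` comb_funs F" using u(2) cls by (auto simp: converges_def)
  next
    fix A assume "A \<in> E ` comb_funs F"
    then obtain f u where "A = E f" "converges u f" using converges_exists by blast
    then show "A \<in> points (comb_space TYPE('k) F)"
      using cls[of u f] converges_imp_cauchy[of u f]
      by (auto simp: comb_space_def completion_def quotient_def)
  qed
  have nonempty: "\<exists>u. u \<in> E f" if "f \<in> comb_funs F" for f
    using converges_exists[OF that] by (simp add: E_def)
  have "inj_on E (comb_funs F)"
  proof (rule inj_onI)
    fix f g assume "f \<in> comb_funs F" "E f = E g"
    then obtain u where "converges u f" "converges u g"
      using nonempty[of f] by (auto simp: E_def)
    then show "f = g" by (rule converges_unique)
  qed
  then have "bij_betw E (points (fun_space F)) (points (comb_space TYPE('k) F))"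
    by (simp add: points fun_space_def bij_betw_def)
  moreover have "E (nadd (fun_space F) f g) = nadd (comb_space TYPE('k) F) (E f) (E g)"
    if "f \<in> comb_funs F" "g \<in> comb_funs F" for f g
  proof -
    have "cauchy_rel (c00_space F) `` {\<lambda>n. nadd (c00_space F) (u n) (v n)}
        = E (nadd (fun_space F) f g)" if "u \<in> E f" "v \<in> E g" for u v
      using cls[OF converges_add[of u f v g]] that by (simp add: E_def c00_space_def fun_space_def)
    then show ?thesis
      using nonempty[OF that(1)] nonempty[OF that(2)]
      by (auto simp: comb_space_def completion_def intro!: UN_constant_eq [symmetric])
  qed
  moreover have "E (nscale (fun_space F) c f) = nscale (comb_space TYPE('k) F) c (E f)"
    if "f \<in> comb_funs F" for c f
  proof -
    have "cauchy_rel (c00_space F) `` {\<lambda>n. nscale (c00_space F) c (u n)}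
        = E (nscale (fun_space F) c f)" if "u \<in> E f" for u
      using cls[OF converges_scale[of u f]] that by (simp add: E_def c00_space_def fun_space_def)
    then show ?thesis
      using nonempty[OF that(1)]
      by (auto simp: comb_space_def completion_def intro!: UN_constant_eq [symmetric])
  qed
  moreover have "nnorm (comb_space TYPE('k) F) (E f) = nnorm (fun_space F) f"
    if "f \<in> comb_funs F" for f
  proof -
    have "(THE r. \<forall>u\<in>E f. (\<lambda>n. family_norm F (u n)) \<longlonglongrightarrow> r) = family_norm F f"
    proof (rule the_equality)
      show "\<forall>u\<in>E f. (\<lambda>n. family_norm F (u n)) \<longlonglongrightarrow> family_norm F f"
        by (simp add: E_def converges_norm)
      then show "r = family_norm F f" if "\<forall>u\<in>E f. (\<lambda>n. family_norm F (u n)) \<longlonglongrightarrow> r" for r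
        using that nonempty[OF \<open>f \<in> comb_funs F\<close>] LIMSEQ_unique by blast
    qed
    then show ?thesis by (simp add: comb_space_def completion_def c00_space_def fun_space_def)
  qed
  ultimately show ?thesis
    unfolding isometric_def by (intro exI[of _ E]) (simp add: fun_space_def)
qed

lemma isometric_trans:
  assumes "isometric U V" "isometric V W"
  shows "isometric U W"
proof -
  obtain S where S: "bij_betw S (points U) (points V)"
    "\<forall>x\<in>points U. \<forall>y\<in>points U. S (nadd U x y) = nadd V (S x) (S y)"
    "\<forall>c. \<forall>x\<in>points U. S (nscale U c x) = nscale V c (S x)"
    "\<forall>x\<in>points U. nnorm V (S x) = nnorm U x"
    using assms(1) unfolding isometric_def by blast
  obtain T where T: "bij_betw T (points V) (points W)"
    "\<forall>x\<in>points V. \<forall>y\<in>points V. T (nadd V x y) = nadd W (T x) (T y)"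
    "\<forall>c. \<forall>x\<in>points V. T (nscale V c x) = nscale W c (T x)"
    "\<forall>x\<in>points V. nnorm W (T x) = nnorm V x"
    using assms(2) unfolding isometric_def by blast
  have "S x \<in> points V" if "x \<in> points U" for x
    using S(1) that by (auto simp: bij_betw_def)
  then show ?thesis
    unfolding isometric_def using bij_betw_trans[OF S(1) T(1)] S(2-) T(2-)
    by (intro exI[of _ "T \<circ> S"]) simp
qed

lemma isometric_sym:
  assumes "isometric V W"
    and add: "\<And>x y. x \<in> points V \<Longrightarrow> y \<in> points V \<Longrightarrow> nadd V x y \<in> points V"
    and scale: "\<And>c x. x \<in> points V \<Longrightarrow> nscale V c x \<in> points V"
  shows "isometric W V"
proof -
  obtain T where T: "bij_betw T (points V) (points W)"
    "\<forall>x\<in>points V. \<forall>y\<in>points V. T (nadd V x y) = nadd W (T x) (T y)"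
    "\<forall>c. \<forall>x\<in>points V. T (nscale V c x) = nscale W c (T x)"
    "\<forall>x\<in>points V. nnorm W (T x) = nnorm V x"
    using assms(1) unfolding isometric_def by blast
  let ?S = "the_inv_into (points V) T"
  have inv: "?S (T x) = x" if "x \<in> points V" for x
    using T(1) that by (auto simp: bij_betw_def the_inv_into_f_f)
  have W: "points W = T ` points V" using T(1) by (simp add: bij_betw_def)
  have "?S (nadd W (T x) (T y)) = nadd V x y" if "x \<in> points V" "y \<in> points V" for x y
    using T(2) inv[OF add[OF that]] that by metis
  moreover have "?S (nscale W c (T x)) = nscale V c x" if "x \<in> points V" for c x
    using T(3) inv[OF scale[OF that]] that by metis
  ultimately show ?thesis
    unfolding isometric_def using bij_betw_the_inv_into[OF T(1)] T(4)
    by (intro exI[of _ ?S]) (auto simp: W inv)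
qed

lemma (in set_family) comb_space_isometric_fun_space:
  "isometric (comb_space TYPE('k::{real_normed_field,banach}) F) (fun_space F)"
proof (rule isometric_sym[OF fun_space_isometric_comb_space])
  fix f g :: "'a \<Rightarrow> 'k"
  assume "f \<in> points (fun_space F)" "g \<in> points (fun_space F)"
  then show "nadd (fun_space F) f g \<in> points (fun_space F)"
    unfolding fun_space_def normed_space.simps by (rule comb_funs_add)
next
  fix c and f :: "'a \<Rightarrow> 'k"
  assume "f \<in> points (fun_space F)"
  then show "nscale (fun_space F) c f \<in> points (fun_space F)"
    unfolding fun_space_def normed_space.simps by (rule comb_funs_scale)
qed

lemma isometric_comb_space_iff_fun_space:
  fixes F :: "'a set set" and G :: "'b set set"
  assumes "family F" "family G"
  shows "isometric (comb_space TYPE('k::{real_normed_field,banach}) F) (comb_space TYPE('k) G)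
     \<longleftrightarrow> isometric (fun_space F :: ('k, _) normed_space) (fun_space G)"
proof -
  interpret F: set_family F using assms(1) by unfold_locales
  interpret G: set_family G using assms(2) by unfold_locales
  show ?thesis
  proof
    assume "isometric (comb_space TYPE('k) F) (comb_space TYPE('k) G)"
    then have "isometric (fun_space F) (comb_space TYPE('k) G)"
      by (rule isometric_trans[OF F.fun_space_isometric_comb_space])
    then show "isometric (fun_space F :: ('k, _) normed_space) (fun_space G)"
      by (rule isometric_trans[OF _ G.comb_space_isometric_fun_space])
  next
    assume "isometric (fun_space F :: ('k, _) normed_space) (fun_space G)"
    then have "isometric (comb_space TYPE('k) F) (fun_space G)"
      by (rule isometric_trans[OF F.comb_space_isometric_fun_space])
    then show "isometric (comb_space TYPE('k) F) (comb_space TYPE('k) G)"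
      by (rule isometric_trans[OF _ G.fun_space_isometric_comb_space])
  qed
qed

section \<open>Compact hereditary families\<close>

lemma sum_norm_indicator:
  "finite t \<Longrightarrow> (\<Sum>j\<in>t. norm (indicator s j :: 'k::real_normed_field)) = real (card (t \<inter> s))"
proof -
  have "norm (indicator s j :: 'k) = (if j \<in> s then 1 else 0)" for j
    by (simp add: indicator_def)
  then show "finite t \<Longrightarrow> ?thesis"
    by (simp add: sum.If_cases Int_def)
qed

locale compact_hereditary = set_family F for F :: "'a set set" +
  assumes compact: "compact_family F" and hered: "hereditary F"
begin

lemma subset_mem: "s \<in> F \<Longrightarrow> t \<subseteq> s \<Longrightarrow> t \<in> F"
  using hered by (auto simp: hereditary_def)

text \<open>
  The finite subsets of a set converge to it, and a compact family is closed. In particular such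
  a set is finite.
\<close>

lemma mem_if_finite_subsets_mem:
  assumes "\<And>E. finite E \<Longrightarrow> E \<subseteq> s \<Longrightarrow> E \<in> F"
  shows "s \<in> F"
proof -
  have "\<exists>t\<in>F. t \<inter> E = s \<inter> E" if "finite E" for E
    using assms[of "s \<inter> E"] that by (intro bexI[of _ "s \<inter> E"]) auto
  then have "char_fun s \<in> closure (char_fun ` F)"
    by (simp add: closure_char_fun_iff)
  then have "char_fun s \<in> char_fun ` F"
    using compact by (simp add: compact_family_def)
  then obtain t where "t \<in> F" "char_fun s = char_fun t" by (elim imageE)
  then have "s = t"
    unfolding char_fun_def by (auto dest: fun_cong)
  then show ?thesis using \<open>t \<in> F\<close> by simp
qed

text \<open>
  On the compact family, \<open>s \<mapsto> (\<Sum>i\<in>s. norm (f i))\<close> is continuous: for a finitely supported function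
  it depends on finitely many coordinates of \<open>s\<close>, and \<open>f\<close> is a limit of such functions uniformly over
  the family. A continuous function on a compact set attains its supremum.
\<close>

lemma norm_attained:
  assumes f: "f \<in> comb_funs F"
  obtains t where "t \<in> F" "(\<Sum>j\<in>t. norm (f j)) = family_norm F f"
proof -
  have "\<exists>x\<in>c00. \<forall>s\<in>F. (\<Sum>i\<in>s. norm (f i - x i)) \<le> inverse (real (Suc n))" for n
    using f unfolding comb_funs_def by simp
  then obtain x where x: "\<And>n. x n \<in> c00"
    "\<And>n s. s \<in> F \<Longrightarrow> (\<Sum>i\<in>s. norm (f i - x n i)) \<le> inverse (real (Suc n))"
    by metis
  (* N and its approximants M n are the sums, as functions on the cube of characteristic functions. *)
  define N where "N g = (\<Sum>i | g i. norm (f i))" for g :: "'a \<Rightarrow> bool"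
  define M where "M n g = (\<Sum>i | x n i \<noteq> 0. if g i then norm (x n i) else 0)"
    for n and g :: "'a \<Rightarrow> bool"
  have fin: "finite {i. x n i \<noteq> 0}" for n
    using x(1) by (simp add: c00_def)
  have "continuous_on UNIV (\<lambda>g. (if g i then norm (x n i) else 0) :: real)" for n i
  proof -
    have "continuous_on UNIV (\<lambda>b. if b then norm (x n i) else 0 :: real)"
      by (simp add: continuous_on_def at_discrete)
    then show ?thesis
      by (rule continuous_on_compose2[OF _ continuous_on_product_coordinates]) simp
  qed
  then have "continuous_on UNIV (M n)" for n
    unfolding M_def by (rule continuous_on_sum)
  then have cont: "continuous_on (char_fun ` F) (M n)" for n
    by (rule continuous_on_subset) simp
  have close: "\<bar>M n (char_fun s) - N (char_fun s)\<bar> \<le> inverse (real (Suc n))" if s: "s \<in> F" for n s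
  proof -
    have "M n (char_fun s) = (\<Sum>i\<in>{i. x n i \<noteq> 0} \<inter> s. norm (x n i))"
      unfolding M_def char_fun_def using fin by (simp add: sum.If_cases Int_def)
    also have "\<dots> = (\<Sum>i\<in>s. norm (x n i))"
      using finite_mem[OF s] by (intro sum.mono_neutral_left) auto
    finally have "\<bar>M n (char_fun s) - N (char_fun s)\<bar> = \<bar>\<Sum>i\<in>s. norm (x n i) - norm (f i)\<bar>"
      by (simp add: N_def char_fun_def sum_subtractf)
    also have "\<dots> \<le> (\<Sum>i\<in>s. norm (f i - x n i))"
      by (intro sum_norm_le[of s, where 'a = real, unfolded real_norm_def])
        (simp add: norm_triangle_ineq3 norm_minus_commute[of "f _"])
    finally show ?thesis using x(2)[OF s] by (rule order_trans)
  qed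
  have "uniform_limit (char_fun ` F) M N sequentially"
  proof (rule uniform_limitI)
    fix e :: real assume "e > 0"
    then have "\<forall>\<^sub>F n in sequentially. inverse (real (Suc n)) < e"
      using order_tendstoD(2)[OF LIMSEQ_inverse_real_of_nat] by blast
    then show "\<forall>\<^sub>F n in sequentially. \<forall>g\<in>char_fun ` F. dist (M n g) (N g) < e"
    proof eventually_elim
      case (elim n)
      show ?case
      proof
        fix g assume "g \<in> char_fun ` F"
        then obtain s where "s \<in> F" "g = char_fun s" by (elim imageE)
        then show "dist (M n g) (N g) < e"
          using close[of s n] elim by (simp add: dist_real_def)
      qed
    qed
  qed
  then have "continuous_on (char_fun ` F) N"
    by (rule uniform_limit_theorem[rotated]) (simp_all add: cont)
  moreover have "compact (char_fun ` F)"
  proof -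
    have "compact_space (euclidean :: bool topology)"
      by (simp add: compact_space_def finite_imp_compact)
    then have "compact_space (euclidean :: ('a \<Rightarrow> bool) topology)"
      unfolding euclidean_product_topology[symmetric] compact_space_product_topology by blast
    then have "compact (UNIV :: ('a \<Rightarrow> bool) set)"
      by (simp add: compact_space_def)
    then show ?thesis
      using compact compact_Int_closed[of UNIV] by (simp add: compact_family_def)
  qed
  moreover have "char_fun ` F \<noteq> {}" using empty_mem by auto
  ultimately have "\<exists>g\<in>char_fun ` F. \<forall>g'\<in>char_fun ` F. N g' \<le> N g"
    by (intro continuous_attains_sup)
  then obtain t where t: "t \<in> F" "\<And>s. s \<in> F \<Longrightarrow> N (char_fun s) \<le> N (char_fun t)"
    by auto
  have "family_norm F f \<le> (\<Sum>j\<in>t. norm (f j))"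
    using t(2) by (intro family_norm_le) (simp add: N_def char_fun_def)
  then show thesis
    using that[OF t(1)] sum_le_family_norm[OF f t(1)] by simp
qed

lemma norm_indicator_mem:
  assumes "s \<in> F"
  shows "family_norm F (indicator s :: 'a \<Rightarrow> 'k::real_normed_field) = card s"
proof (rule antisym)
  have fin: "finite s" using assms by (rule finite_mem)
  show "family_norm F (indicator s :: 'a \<Rightarrow> 'k) \<le> card s"
    using fin by (intro family_norm_le) (simp add: sum_norm_indicator finite_mem card_mono)
  show "card s \<le> family_norm F (indicator s :: 'a \<Rightarrow> 'k)"
    using sum_le_family_norm[OF indicator_comb_funs[OF fin] assms, where 'b = 'k] fin
    by (simp add: sum_norm_indicator)
qed

text \<open>
  The sum of the indicator of \<open>s\<close> over \<open>t\<close> is \<open>card (t \<inter> s)\<close>. If the norm, which is attained, equals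
  \<open>card s\<close>, then some member of the family contains \<open>s\<close>. Together with \<open>norm_indicator_mem\<close>, this
  recovers the family from its norm.
\<close>

lemma mem_if_norm_indicator:
  assumes "finite s" "family_norm F (indicator s :: 'a \<Rightarrow> 'k::real_normed_field) = card s"
  shows "s \<in> F"
proof -
  obtain t where t: "t \<in> F"
    "(\<Sum>j\<in>t. norm (indicator s j :: 'k)) = family_norm F (indicator s :: 'a \<Rightarrow> 'k)"
    using norm_attained[OF indicator_comb_funs[OF assms(1)]] .
  then have "card (t \<inter> s) = card s"
    using assms(2) finite_mem[OF t(1)] by (simp add: sum_norm_indicator)
  then have "t \<inter> s = s"
    using assms(1) by (intro card_subset_eq) auto
  then show ?thesis using t(1) subset_mem by blast
qed

text \<open>
  A member \<open>t \<noteq> s\<close> misses a point of the maximal set \<open>s\<close>, so its sum at the indicator of \<open>s\<close> is at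
  most \<open>card s - 1\<close>. A perturbation of norm at most \<open>1 / 2\<close> cannot close this gap of 1. So near
  the indicator the sum over \<open>s\<close> alone computes the norm, which makes the indicator a point of
  differentiability.
\<close>

lemma norm_near_maximal_indicator:
  assumes s: "s \<in> maximal_sets F" and y: "y \<in> comb_funs F" "family_norm F y \<le> 1 / 2"
  shows "family_norm F (\<lambda>i. indicator s i + y i) \<le> (\<Sum>i\<in>s. norm (1 + y i))"
proof (rule family_norm_le)
  fix t assume t: "t \<in> F"
  have sF: "s \<in> F" using s by (simp add: maximal_sets_def)
  show "(\<Sum>i\<in>t. norm (indicator s i + y i)) \<le> (\<Sum>i\<in>s. norm (1 + y i))"
  proof (cases "t = s")
    case False
    then have "\<not> s \<subseteq> t" using s t by (auto simp: maximal_sets_def)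
    then have "card (t \<inter> s) < card s"
      using finite_mem[OF sF] by (intro psubset_card_mono) auto
    then have lt: "real (card (t \<inter> s)) \<le> real (card s) - 1" by linarith
    have "(\<Sum>i\<in>t. norm (indicator s i + y i)) \<le> (\<Sum>i\<in>t. norm (indicator s i :: 'b) + norm (y i))"
      by (intro sum_mono norm_triangle_ineq)
    also have "\<dots> \<le> real (card s) - 1 + 1 / 2"
      unfolding sum.distrib sum_norm_indicator[OF finite_mem[OF t]]
      using lt sum_le_family_norm[OF y(1) t] y(2) by linarith
    also have "\<dots> \<le> real (card s) - (\<Sum>i\<in>s. norm (y i))"
      using sum_le_family_norm[OF y(1) sF] y(2) by linarith
    also have "\<dots> = (\<Sum>i\<in>s. 1 - norm (y i))"
      by (simp add: sum_subtractf)
    also have "\<dots> \<le> (\<Sum>i\<in>s. norm (1 + y i))"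
    proof (rule sum_mono)
      show "1 - norm (y i) \<le> norm (1 + y i)" for i
        using norm_diff_ineq[of 1 "y i"] by simp
    qed
    finally show ?thesis .
  qed simp
qed

text \<open>
  If \<open>{i}\<close> is a limit of maximal sets \<open>s\<close>, then evaluation at \<open>i\<close> is the pointwise limit of the
  functionals \<open>y \<mapsto> (\<Sum>j\<in>s. y j)\<close>: choose \<open>s\<close> to meet the supports of finitely supported approximants
  at most in \<open>i\<close>, and the rest of the sum is bounded by the approximation error.
\<close>

lemma evaluation_limit_of_maximal_sums:
  assumes i: "{i} \<in> family_closure (maximal_sets F)"
    and Y: "finite Y" "Y \<subseteq> comb_funs F" and e: "e > 0"
  obtains s where "s \<in> maximal_sets F" "\<And>y. y \<in> Y \<Longrightarrow> norm ((\<Sum>j\<in>s. y j) - y i) \<le> e"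
proof -
  have "\<forall>y\<in>Y. \<exists>x\<in>c00. \<forall>s\<in>F. (\<Sum>j\<in>s. norm (y j - x j)) \<le> e"
    using Y(2) e unfolding comb_funs_def by auto
  then obtain x where x: "\<And>y. y \<in> Y \<Longrightarrow> x y \<in> c00"
    "\<And>y s. y \<in> Y \<Longrightarrow> s \<in> F \<Longrightarrow> (\<Sum>j\<in>s. norm (y j - x y j)) \<le> e"
    by metis
  let ?E = "insert i (\<Union>y\<in>Y. {j. x y j \<noteq> 0})"
  have "finite ?E" using Y(1) x(1) by (auto simp: c00_def)
  then obtain s where s: "s \<in> maximal_sets F" "s \<inter> ?E = {i} \<inter> ?E"
    using i unfolding family_closure_def mem_Collect_eq closure_char_fun_iff by blast
  then have sF: "s \<in> F" and "i \<in> s" by (auto simp: maximal_sets_def)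
  have "norm ((\<Sum>j\<in>s. y j) - y i) \<le> e" if y: "y \<in> Y" for y
  proof -
    have zero: "x y j = 0" if "j \<in> s - {i}" for j
      using s(2) that y by blast
    have "(\<Sum>j\<in>s. y j) - y i = (\<Sum>j\<in>s - {i}. y j)"
      using finite_mem[OF sF] \<open>i \<in> s\<close> by (simp add: sum_diff1)
    also have "norm \<dots> \<le> (\<Sum>j\<in>s - {i}. norm (y j - x y j))"
      by (intro sum_norm_le) (simp add: zero)
    also have "\<dots> \<le> (\<Sum>j\<in>s. norm (y j - x y j))"
      using finite_mem[OF sF] by (intro sum_mono2) auto
    also have "\<dots> \<le> e" using x(2)[OF y sF] .
    finally show ?thesis .
  qed
  then show thesis using that s(1) by blast
qed

end

section \<open>First-order expansion of the modulus\<close>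

text \<open>
  The classes \<^class>\<open>real_normed_field\<close> and \<^class>\<open>real_inner\<close> cover the real and the complex field
  at once. There \<open>inner 1 u\<close> is the real part of \<open>u\<close>, and the lemma bounds the modulus by its
  first-order expansion at 1 with a quadratic error.
\<close>

lemma norm_one_plus_le:
  fixes u :: "'k::{real_normed_field,real_inner}"
  shows "norm (1 + u) \<le> 1 + inner 1 u + (norm u)\<^sup>2"
proof (rule power2_le_imp_le)
  have "\<bar>inner 1 u\<bar> \<le> norm u"
    using Cauchy_Schwarz_ineq2[of 1 u] by simp
  moreover have "norm u \<le> 1 + (norm u)\<^sup>2"
    using sum_squares_bound[of "norm u" 1] zero_le_power2[of "norm u"] norm_ge_zero[of u]
    by (simp only: power_one mult_1_right)
  ultimately show "0 \<le> 1 + inner 1 u + (norm u)\<^sup>2" by linarith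
  define q where "q = inner 1 u + (norm u)\<^sup>2"
  have "(norm (1 + u))\<^sup>2 = 1 + 2 * q - (norm u)\<^sup>2"
    by (simp add: q_def dot_norm field_simps)
  also have "\<dots> \<le> 1 + 2 * q + q\<^sup>2"
    using zero_le_power2[of "norm u"] zero_le_power2[of q] by linarith
  also have "\<dots> = (1 + q)\<^sup>2"
    by (simp add: power2_sum)
  finally show "(norm (1 + u))\<^sup>2 \<le> (1 + inner 1 u + (norm u)\<^sup>2)\<^sup>2"
    by (simp add: q_def add.assoc)
qed

text \<open>
  The modulus is convex, so it lies above its linearisation at any nonzero point.
\<close>

lemma norm_plus_inner_sgn_le:
  fixes z v :: "'k::real_inner"
  assumes "z \<noteq> 0"
  shows "norm z + inner (sgn z) v \<le> norm (z + v)"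
proof -
  have "inner (sgn z) z = norm z"
    using assms by (simp add: sgn_div_norm dot_square_norm power2_eq_square)
  then have "norm z + inner (sgn z) v = inner (sgn z) (z + v)"
    by (simp add: inner_add_right)
  also have "\<dots> \<le> norm (sgn z) * norm (z + v)"
    by (rule norm_cauchy_schwarz)
  finally show ?thesis using assms by (simp add: norm_sgn)
qed

text \<open>
  Multiplication by a unimodular scalar preserves the modulus, hence by polarisation the inner
  product.
\<close>

lemma inner_mult_cancel_unimodular:
  fixes a :: "'k::{real_normed_field,real_inner}"
  assumes "norm a = 1"
  shows "inner (a * b) (a * c) = inner b c"
  using assms by (simp add: dot_norm norm_mult flip: distrib_left)

text \<open>
  Both signs of \<open>h\<close> are admitted, so a linear term dominated by a quadratic one must vanish.
  This is how derivatives are compared without introducing them.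
\<close>

lemma zero_if_small_multiples_quadratic:
  fixes d :: real
  assumes "\<delta> > 0" and le: "\<And>h. \<bar>h\<bar> \<le> \<delta> \<Longrightarrow> h * d \<le> h\<^sup>2 * C"
  shows "d = 0"
proof -
  have "\<bar>d\<bar> \<le> k * C" if "0 < k" "k \<le> \<delta>" for k
  proof -
    have "k * d \<le> k * (k * C)" "k * (- d) \<le> k * (k * C)"
      using le[of k] le[of "- k"] that by (simp_all add: power2_eq_square mult.assoc)
    then have "d \<le> k * C" "- d \<le> k * C"
      using mult_le_cancel_left_pos[OF that(1)] by blast+
    then show ?thesis by (simp add: abs_le_iff)
  qed
  then have "\<forall>\<^sub>F k in at_right 0. \<bar>d\<bar> \<le> k * C"
    using assms(1) unfolding eventually_at_right_field by (intro exI[of _ \<delta>]) auto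
  moreover have "((\<lambda>k. k * C) \<longlongrightarrow> 0 * C) (at_right 0)"
    by (intro tendsto_intros)
  ultimately have "\<bar>d\<bar> \<le> 0 * C"
    by (intro tendsto_lowerbound[where F = "at_right (0::real)"]) auto
  then show ?thesis by simp
qed

section \<open>Isometries permute the coordinates\<close>

text \<open>
  The axioms are symmetric under exchanging \<open>F\<close> with \<open>G\<close> and \<open>T\<close> with \<open>T'\<close>, so that everything
  proved about \<open>T'\<close> can be reused for \<open>T\<close> by interpreting the locale a second time.
\<close>

locale comb_isometry = F: compact_hereditary F + G: compact_hereditary G
  for F :: "'a set set" and G :: "'b set set" +
  fixes T :: "('a \<Rightarrow> 'k::{real_normed_field,real_inner}) \<Rightarrow> 'b \<Rightarrow> 'k" and T' :: "('b \<Rightarrow> 'k) \<Rightarrow> 'a \<Rightarrow> 'k"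
  assumes T_mem: "f \<in> comb_funs F \<Longrightarrow> T f \<in> comb_funs G"
    and T'_mem: "g \<in> comb_funs G \<Longrightarrow> T' g \<in> comb_funs F"
    and T'_T: "f \<in> comb_funs F \<Longrightarrow> T' (T f) = f"
    and T_T': "g \<in> comb_funs G \<Longrightarrow> T (T' g) = g"
    and T_add: "f \<in> comb_funs F \<Longrightarrow> f' \<in> comb_funs F \<Longrightarrow> T (\<lambda>i. f i + f' i) = (\<lambda>j. T f j + T f' j)"
    and T'_add: "g \<in> comb_funs G \<Longrightarrow> g' \<in> comb_funs G \<Longrightarrow> T' (\<lambda>j. g j + g' j) = (\<lambda>i. T' g i + T' g' i)"
    and T_scale: "f \<in> comb_funs F \<Longrightarrow> T (\<lambda>i. c * f i) = (\<lambda>j. c * T f j)"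
    and T'_scale: "g \<in> comb_funs G \<Longrightarrow> T' (\<lambda>j. c * g j) = (\<lambda>i. c * T' g i)"
    and T_norm: "f \<in> comb_funs F \<Longrightarrow> family_norm G (T f) = family_norm F f"
    and T'_norm: "g \<in> comb_funs G \<Longrightarrow> family_norm F (T' g) = family_norm G g"
    and F_singleton: "{i} \<in> family_closure (maximal_sets F)"
    and G_singleton: "{j} \<in> family_closure (maximal_sets G)"
begin

lemma inverse_isometry: "comb_isometry G F T' T"
  by unfold_locales
    (simp_all add: T_mem T'_mem T'_T T_T' T_add T'_add T_scale T'_scale T_norm T'_norm
      F_singleton G_singleton)

lemma T'_diff:
  assumes "g \<in> comb_funs G" "g' \<in> comb_funs G"
  shows "T' (\<lambda>j. g j - g' j) = (\<lambda>i. T' g i - T' g' i)"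
  using T'_add[OF assms(1) comb_funs_scale[OF assms(2), of "-1"]] T'_scale[OF assms(2), of "-1"]
  by simp

lemma T'_sum:
  assumes "\<And>k. k \<in> K \<Longrightarrow> g k \<in> comb_funs G"
  shows "T' (\<lambda>j. \<Sum>k\<in>K. g k j) = (\<lambda>i. \<Sum>k\<in>K. T' (g k) i)"
proof -
  have zero: "T' (\<lambda>j. 0) = (\<lambda>i. 0)"
    using T'_scale[OF c00_imp_comb_funs[OF c00_0], of 0] by simp
  show ?thesis
    using assms
  proof (induction K rule: infinite_finite_induct)
    case (insert k K)
    then show ?case
      using T'_add[of "g k" "\<lambda>j. \<Sum>k\<in>K. g k j"] comb_funs_sum[of K g G] by simp
  qed (simp_all add: zero)
qed

text \<open>
  The matrix of \<open>T'\<close> and the supports of its rows; columns are images of unit vectors.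
\<close>

abbreviation entry :: "'a \<Rightarrow> 'b \<Rightarrow> 'k" where
  "entry i k \<equiv> T' (indicator {k}) i"

abbreviation row :: "'a \<Rightarrow> 'b set" where
  "row i \<equiv> {k. entry i k \<noteq> 0}"

text \<open>
  Let \<open>z\<close> be the image of the indicator of the maximal set \<open>s\<close>, and let \<open>t0 \<in> G\<close> attain its norm.
  Along the line \<open>z + h w\<close>, the norm is at least the sum over the support of \<open>z\<close> in \<open>t0\<close>, which lies above
  its linearisation. It is also at most the norm of the preimage, which near the indicator is a
  sum over \<open>s\<close> with quadratic error. Both bounds agree at \<open>h = 0\<close>, so their slopes agree. Only
  real parts are compared here; the scalars are recovered in the next lemma.
\<close>

lemma smooth_point_functional:
  assumes s: "s \<in> maximal_sets F"
  obtains t a where "t \<in> G" "\<And>j. j \<in> t \<Longrightarrow> norm (a j) = 1"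
    "\<And>w. w \<in> comb_funs G \<Longrightarrow> (\<Sum>i\<in>s. inner 1 (T' w i)) = (\<Sum>j\<in>t. inner (a j) (w j))"
proof -
  have sF: "s \<in> F" using s by (simp add: maximal_sets_def)
  note fin = F.finite_mem[OF sF]
  define z where "z = T (indicator s)"
  have z: "z \<in> comb_funs G" by (simp add: z_def T_mem fin)
  have norm_z: "family_norm G z = card s"
    by (simp add: z_def T_norm fin F.norm_indicator_mem[OF sF])
  obtain t0 where t0: "t0 \<in> G" "(\<Sum>j\<in>t0. norm (z j)) = family_norm G z"
    using G.norm_attained[OF z] .
  define t where "t = {j \<in> t0. z j \<noteq> 0}"
  have tG: "t \<in> G" by (rule G.subset_mem[OF t0(1)]) (auto simp: t_def)
  have norm_t: "(\<Sum>j\<in>t. norm (z j)) = card s"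
  proof -
    have "(\<Sum>j\<in>t. norm (z j)) = (\<Sum>j\<in>t0. norm (z j))"
      using G.finite_mem[OF t0(1)] by (intro sum.mono_neutral_left) (auto simp: t_def)
    then show ?thesis by (simp add: t0(2) norm_z)
  qed
  have "(\<Sum>i\<in>s. inner 1 (T' w i)) = (\<Sum>j\<in>t. inner (sgn (z j)) (w j))"
    if w: "w \<in> comb_funs G" for w
  proof -
    define y where "y = T' w"
    define L where "L = (\<Sum>j\<in>t. inner (sgn (z j)) (w j))"
    define R where "R = (\<Sum>i\<in>s. inner 1 (y i))"
    define C where "C = (\<Sum>i\<in>s. (norm (y i))\<^sup>2)"
    have y: "y \<in> comb_funs F" by (simp add: y_def T'_mem w)
    have Ty: "T y = w" by (simp add: y_def T_T' w)
    (* For real h up to this size, h * y has norm at most 1 / 2, as the local norm formula requires;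
       the summand 1 avoids a vanishing denominator. *)
    define \<delta> where "\<delta> = 1 / (2 * (family_norm F y + 1))"
    have \<delta>: "\<delta> > 0" using F.family_norm_nonneg[OF y] by (simp add: \<delta>_def)
    have "h * (L - R) \<le> h\<^sup>2 * C" if h: "\<bar>h\<bar> \<le> \<delta>" for h :: real
    proof -
      let ?c = "of_real h :: 'k"
      have small: "family_norm F (\<lambda>i. ?c * y i) \<le> 1 / 2"
      proof -
        have "family_norm F (\<lambda>i. ?c * y i) \<le> \<bar>h\<bar> * family_norm F y"
          using F.family_norm_scale_le[OF y, of ?c] by simp
        also have "\<dots> \<le> \<delta> * (family_norm F y + 1)"
          using h F.family_norm_nonneg[OF y] \<delta> by (intro mult_mono) auto
        also have "\<dots> = 1 / 2"
          using F.family_norm_nonneg[OF y] by (simp add: \<delta>_def)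
        finally show ?thesis .
      qed
      have scalar: "inner b (?c * v) = h * inner b v" for b v :: 'k
        by (simp flip: scaleR_conv_of_real)
      have "card s + h * L = (\<Sum>j\<in>t. norm (z j) + inner (sgn (z j)) (?c * w j))"
        by (simp add: sum.distrib norm_t L_def scalar sum_distrib_left)
      also have "\<dots> \<le> (\<Sum>j\<in>t. norm (z j + ?c * w j))"
        by (intro sum_mono norm_plus_inner_sgn_le) (simp add: t_def)
      also have "\<dots> \<le> family_norm G (\<lambda>j. z j + ?c * w j)"
        by (intro G.sum_le_family_norm tG comb_funs_add comb_funs_scale z w)
      also have "(\<lambda>j. z j + ?c * w j) = T (\<lambda>i. indicator s i + ?c * y i)"
        using T_add[OF indicator_comb_funs[OF fin] comb_funs_scale[OF y, of ?c]] T_scale[OF y, of ?c]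
        by (simp add: z_def Ty)
      also have "family_norm G \<dots> = family_norm F (\<lambda>i. indicator s i + ?c * y i)"
        by (intro T_norm comb_funs_add comb_funs_scale y indicator_comb_funs fin)
      also have "\<dots> \<le> (\<Sum>i\<in>s. norm (1 + ?c * y i))"
        by (rule F.norm_near_maximal_indicator[OF s comb_funs_scale[OF y] small])
      also have "\<dots> \<le> (\<Sum>i\<in>s. 1 + inner 1 (?c * y i) + (norm (?c * y i))\<^sup>2)"
        by (intro sum_mono norm_one_plus_le)
      also have "\<dots> = card s + h * R + h\<^sup>2 * C"
        by (simp add: sum.distrib R_def C_def scalar sum_distrib_left norm_mult power_mult_distrib)
      finally show ?thesis by (simp add: right_diff_distrib)
    qed
    then have "L - R = 0" by (rule zero_if_small_multiples_quadratic[OF \<delta>])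
    then show ?thesis by (simp add: L_def R_def y_def)
  qed
  then show thesis
    using tG by (intro that[of t "\<lambda>j. sgn (z j)"]) (simp_all add: t_def norm_sgn)
qed

text \<open>
  Two scalars with the same real part after every rotation and scaling coincide. Testing the
  identity of real parts on the multiples \<open>c\<close> of a unit vector therefore identifies each coefficient
  of the functional: it is the inverse of the unimodular \<open>a k\<close>, or 0 off \<open>t\<close>.
\<close>

lemma maximal_sum_entries:
  assumes s: "s \<in> maximal_sets F"
  obtains t where "t \<in> G" "\<And>k. norm (\<Sum>i\<in>s. entry i k) = (if k \<in> t then 1 else 0)"
proof -
  obtain t a where t: "t \<in> G" "\<And>j. j \<in> t \<Longrightarrow> norm (a j) = 1"
    "\<And>w. w \<in> comb_funs G \<Longrightarrow> (\<Sum>i\<in>s. inner 1 (T' w i)) = (\<Sum>j\<in>t. inner (a j) (w j))"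
    using smooth_point_functional[OF s] by metis
  have "norm (\<Sum>i\<in>s. entry i k) = (if k \<in> t then 1 else 0)" for k
  proof -
    define b where "b = (\<Sum>i\<in>s. entry i k)"
    have key: "inner 1 (c * b) = (if k \<in> t then inner (a k) c else 0)" for c
    proof -
      have "inner 1 (c * b) = (\<Sum>i\<in>s. inner 1 (T' (\<lambda>j. c * indicator {k} j) i))"
        by (simp add: T'_scale b_def sum_distrib_left inner_sum_right)
      also have "\<dots> = (\<Sum>j\<in>t. inner (a j) (c * indicator {k} j))"
        by (intro t(3) comb_funs_scale) simp
      also have "\<dots> = (\<Sum>j\<in>t. if j = k then inner (a k) c else 0)"
        by (intro sum.cong) (auto simp: indicator_def)
      finally show ?thesis using G.finite_mem[OF t(1)] by simp
    qed
    (* d is the difference between the coefficient and its claimed value. *)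
    define d where "d = (if k \<in> t then b - inverse (a k) else b)"
    have "inner 1 (c * d) = 0" for c
    proof (cases "k \<in> t")
      case True
      then have a: "norm (a k) = 1" "a k \<noteq> 0" using t(2)[of k] by auto
      have "inner 1 (c * inverse (a k)) = inner (a k) c"
        using inner_mult_cancel_unimodular[OF a(1), of 1 "c * inverse (a k)"] a(2)
        by (simp add: mult.left_commute)
      then show ?thesis using True key by (simp add: d_def right_diff_distrib inner_diff_right)
    qed (simp add: d_def key)
    from this[of "inverse d"] have "d = 0"
      by (cases "d = 0") (simp_all add: dot_square_norm)
    then have "b = (if k \<in> t then inverse (a k) else 0)"
      by (simp add: d_def split: if_splits)
    then show ?thesis
      using t(2) by (simp add: norm_inverse flip: b_def)
  qed
  then show thesis using that t(1) by blast
qed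

text \<open>
  A row is a pointwise limit of the functionals of the previous lemma, since evaluation at \<open>i\<close> is a
  limit of sums over maximal sets. The same \<open>t\<close> serves for all of the finitely many columns in
  \<open>K\<close>, which is what makes the supports of rows controllable.
\<close>

lemma entries_approx:
  assumes K: "finite K" and e: "e > 0"
  obtains t b where "t \<in> G" "\<And>k. norm (b k) = (if k \<in> t then 1 else 0)"
    "\<And>k. k \<in> K \<Longrightarrow> norm (b k - entry i k) \<le> e"
proof -
  let ?Y = "(\<lambda>k. T' (indicator {k})) ` K"
  have Y: "finite ?Y" "?Y \<subseteq> comb_funs F" using K by (auto intro: T'_mem)
  obtain s where s: "s \<in> maximal_sets F" "\<And>y. y \<in> ?Y \<Longrightarrow> norm ((\<Sum>j\<in>s. y j) - y i) \<le> e"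
    using F.evaluation_limit_of_maximal_sums[OF F_singleton Y e] by metis
  obtain t where "t \<in> G" "\<And>k. norm (\<Sum>i\<in>s. entry i k) = (if k \<in> t then 1 else 0)"
    using maximal_sum_entries[OF s(1)] by metis
  then show thesis
    using s(2) by (intro that[of t "\<lambda>k. \<Sum>j\<in>s. entry j k"]) auto
qed

text \<open>
  Limits of numbers of modulus 0 or 1 have modulus 0 or 1.
\<close>

lemma norm_entry: "norm (entry i k) = (if k \<in> row i then 1 else 0)"
proof -
  have "norm (entry i k) = 1" if "entry i k \<noteq> 0"
  proof (rule ccontr)
    assume ne: "norm (entry i k) \<noteq> 1"
    (* Half the distance from the modulus to the set {0, 1}. *)
    define e where "e = min (norm (entry i k)) \<bar>1 - norm (entry i k)\<bar> / 2"
    have "e > 0" using ne that by (simp add: e_def)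
    then obtain t b where b: "norm (b k) = (if k \<in> t then 1 else 0)" "norm (b k - entry i k) \<le> e"
      using entries_approx[of "{k}" e i] by (metis singletonI finite.emptyI finite.insertI)
    have "\<bar>norm (b k) - norm (entry i k)\<bar> \<le> e"
      using norm_triangle_ineq3 b(2) by (rule order_trans)
    moreover have "2 * e \<le> norm (entry i k)" "2 * e \<le> \<bar>1 - norm (entry i k)\<bar>"
      by (simp_all add: e_def)
    ultimately show False using b(1) \<open>e > 0\<close> by (auto split: if_splits)
  qed
  then show ?thesis by simp
qed

text \<open>
  On a finite part of the row, an approximation within \<open>1 / 2\<close> of unimodular entries has nonzero
  coefficients, so that part is contained in a member of \<open>G\<close>. Compactness passes from the finite
  parts to the whole row support.
\<close>

lemma row_mem: "row i \<in> G"
proof (rule G.mem_if_finite_subsets_mem)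
  fix K assume K: "finite K" "K \<subseteq> row i"
  obtain t b where t: "t \<in> G" "\<And>k. norm (b k) = (if k \<in> t then 1 else 0)"
    "\<And>k. k \<in> K \<Longrightarrow> norm (b k - entry i k) \<le> 1 / 2"
    using entries_approx[OF K(1), of "1 / 2" i] by (metis half_gt_zero zero_less_one)
  have "k \<in> t" if "k \<in> K" for k
  proof (rule ccontr)
    assume "k \<notin> t"
    then have "b k = 0" using t(2)[of k] by simp
    then have "norm (entry i k) \<le> 1 / 2" using t(3)[OF that] by simp
    moreover have "norm (entry i k) = 1" using that K(2) norm_entry[of k i] by auto
    ultimately show False by simp
  qed
  then show "K \<in> G" using t(1) G.subset_mem by blast
qed

text \<open>
  On finitely supported functions this is linearity. Since the support of the row lies in \<open>G\<close> and its
  entries are unimodular, both sides are bounded by the norm, so they agree on the closure.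
\<close>

lemma T'_eq_row_sum:
  assumes w: "w \<in> comb_funs G"
  shows "T' w i = (\<Sum>k\<in>row i. entry i k * w k)"
proof -
  have fin: "finite (row i)" by (rule G.finite_mem[OF row_mem])
  have c00: "T' x i = (\<Sum>k\<in>row i. entry i k * x k)" if x: "x \<in> c00" for x
  proof -
    let ?S = "{k. x k \<noteq> 0}"
    have S: "finite ?S" using x by (simp add: c00_def)
    have "x = (\<lambda>j. \<Sum>k\<in>?S. x k * indicator {k} j)"
    proof
      fix j
      have "(\<Sum>k\<in>?S. x k * indicator {k} j) = (\<Sum>k\<in>?S. if k = j then x j else 0)"
        by (intro sum.cong) (auto simp: indicator_def)
      then show "x j = (\<Sum>k\<in>?S. x k * indicator {k} j)" using S by simp
    qed
    then have "T' x i = T' (\<lambda>j. \<Sum>k\<in>?S. x k * indicator {k} j) i" by simp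
    also have "\<dots> = (\<Sum>k\<in>?S. x k * entry i k)"
      by (simp add: T'_sum T'_scale comb_funs_scale)
    also have "\<dots> = (\<Sum>k\<in>row i. entry i k * x k)"
      using S fin by (intro sum.mono_neutral_cong) (auto simp: mult.commute)
    finally show ?thesis .
  qed
  have "norm (T' w i - (\<Sum>k\<in>row i. entry i k * w k)) \<le> e" if "e > 0" for e
  proof -
    obtain x where x: "x \<in> c00" "family_norm G (\<lambda>j. w j - x j) \<le> e / 2"
      using G.c00_dense[OF w, of "e / 2"] \<open>e > 0\<close> by auto
    note xG = c00_imp_comb_funs[OF x(1), of G]
    note diff = comb_funs_diff[OF w xG]
    have "T' w i - (\<Sum>k\<in>row i. entry i k * w k)
        = T' (\<lambda>j. w j - x j) i - (\<Sum>k\<in>row i. entry i k * (w k - x k))"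
      by (simp add: T'_diff[OF w xG] c00[OF x(1)] right_diff_distrib sum_subtractf)
    also have "norm \<dots> \<le> norm (T' (\<lambda>j. w j - x j) i) + norm (\<Sum>k\<in>row i. entry i k * (w k - x k))"
      by (rule norm_triangle_ineq4)
    also have "norm (T' (\<lambda>j. w j - x j) i) \<le> e / 2"
      using F.norm_coord_le[OF T'_mem[OF diff], of i] x(2) by (simp add: T'_norm[OF diff])
    also have "norm (\<Sum>k\<in>row i. entry i k * (w k - x k)) \<le> (\<Sum>k\<in>row i. norm (w k - x k))"
      by (intro sum_norm_le) (simp add: norm_mult norm_entry)
    also have "\<dots> \<le> e / 2"
      using G.sum_le_family_norm[OF diff row_mem] x(2) by (rule order_trans)
    finally show ?thesis by simp
  qed
  then have "norm (T' w i - (\<Sum>k\<in>row i. entry i k * w k)) \<le> 0"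
    by (rule field_le_epsilon[of _ 0, simplified])
  then show ?thesis by simp
qed

text \<open>
  For distinct \<open>l\<close>, \<open>l'\<close> in the support of row \<open>i\<close> the pair \<open>{l, l'}\<close> belongs to \<open>G\<close>. A unit vector
  has norm 1, so its image cannot have modulus 1 at both \<open>l\<close> and \<open>l'\<close>. Hence the sum over the row
  that expresses \<open>T' (T e) i = e i\<close>, for a unit vector \<open>e\<close>, has at most one nonzero term. For a
  unit vector other than the \<open>i\<close>-th one the sum is 0 and no term survives; for the \<open>i\<close>-th one exactly one
  term, at some \<open>l\<close>, survives. Any further \<open>l'\<close> in the support would give a zero row of the matrix of \<open>T\<close>,
  contradicting surjectivity.
\<close>

lemma row_singleton: "\<exists>l. row i = {l}"
proof -
  interpret inv: comb_isometry G F T' T by (rule inverse_isometry)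
  have delta: "(\<Sum>l\<in>row i. entry i l * inv.entry l k) = indicator {k} i" for k
    using T'_eq_row_sum[OF T_mem[OF indicator_comb_funs[of "{k}"]], of i] by (simp add: T'_T)
  have disjoint: "inv.entry l k = 0 \<or> inv.entry l' k = 0"
    if "l \<in> row i" "l' \<in> row i" "l \<noteq> l'" for l l' k
  proof (rule ccontr)
    assume "\<not> ?thesis"
    then have "(\<Sum>j\<in>{l, l'}. norm (inv.entry j k)) = 2"
      using that(3) inv.norm_entry[of k l] inv.norm_entry[of k l'] by simp
    moreover have "{l, l'} \<in> G"
      using that by (intro G.subset_mem[OF row_mem[of i]]) auto
    ultimately have "2 \<le> family_norm G (T (indicator {k}))"
      using G.sum_le_family_norm[OF T_mem[OF indicator_comb_funs[of "{k}"]], of "{l, l'}"] by simp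
    then show False by (simp add: T_norm F.norm_indicator_singleton)
  qed
  have sum_eq: "(\<Sum>l'\<in>row i. entry i l' * inv.entry l' k) = entry i l * inv.entry l k"
    if "l \<in> row i" "inv.entry l k \<noteq> 0" for l k
  proof -
    have "(\<Sum>l'\<in>row i. entry i l' * inv.entry l' k) = (\<Sum>l'\<in>{l}. entry i l' * inv.entry l' k)"
      using that disjoint[OF that(1)] G.finite_mem[OF row_mem[of i]]
      by (intro sum.mono_neutral_right) auto
    then show ?thesis by simp
  qed
  have off: "inv.entry l k = 0" if "l \<in> row i" "k \<noteq> i" for l k
    using sum_eq[OF that(1), of k] delta[of k] that by auto
  have "(\<Sum>l\<in>row i. entry i l * inv.entry l i) \<noteq> 0" using delta[of i] by simp
  then obtain l where l: "l \<in> row i" "inv.entry l i \<noteq> 0"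
    by (metis (mono_tags, lifting) mult_zero_right sum.neutral)
  have "l' = l" if l': "l' \<in> row i" for l'
  proof (rule ccontr)
    assume "l' \<noteq> l"
    then have "inv.entry l' i = 0" using disjoint[OF l' l(1)] l(2) by auto
    then have "inv.entry l' k = 0" for k using off[OF l', of k] by (cases "k = i") auto
    then have "T f l' = 0" if "f \<in> comb_funs F" for f
      using inv.T'_eq_row_sum[OF that, of l'] by simp
    from this[OF T'_mem[OF indicator_comb_funs[of "{l'}"]]] show False
      by (simp add: T_T')
  qed
  then show ?thesis using l(1) by blast
qed

lemma T'_weighted_composition:
  "\<exists>\<sigma>. \<forall>i. \<forall>g\<in>comb_funs G. norm (T' g i) = norm (g (\<sigma> i))"
proof -
  obtain \<sigma> where \<sigma>: "\<And>i. row i = {\<sigma> i}" using row_singleton by metis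
  have "norm (T' g i) = norm (g (\<sigma> i))" if "g \<in> comb_funs G" for g i
  proof -
    have "\<sigma> i \<in> row i" by (simp only: \<sigma> singletonI)
    then show ?thesis
      using T'_eq_row_sum[OF that, of i] norm_entry[of "\<sigma> i" i] by (simp only: \<sigma>) (simp add: norm_mult)
  qed
  then show ?thesis by blast
qed

text \<open>
  The index maps of \<open>T'\<close> and \<open>T\<close> are mutually inverse, as is seen on unit vectors. So \<open>T'\<close>
  turns the indicator of \<open>\<sigma> ` s\<close> into a function with the moduli of the indicator of \<open>s\<close>, and the norms of
  indicators decide membership in the families.
\<close>

lemma families_related_by_bijection: "\<exists>\<sigma>. bij \<sigma> \<and> G = {\<sigma> ` s | s. s \<in> F}"
proof -
  interpret inv: comb_isometry G F T' T by (rule inverse_isometry)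
  obtain \<sigma> where \<sigma>: "\<And>i g. g \<in> comb_funs G \<Longrightarrow> norm (T' g i) = norm (g (\<sigma> i))"
    using T'_weighted_composition by blast
  obtain \<tau> where \<tau>: "\<And>j f. f \<in> comb_funs F \<Longrightarrow> norm (T f j) = norm (f (\<tau> j))"
    using inv.T'_weighted_composition by blast
  have "\<tau> (\<sigma> i) = i" for i
  proof -
    have "norm (T' (T (indicator {i})) i) = norm (indicator {i} (\<tau> (\<sigma> i)) :: 'k)"
      by (simp add: \<sigma> \<tau> T_mem)
    then show ?thesis by (cases "\<tau> (\<sigma> i) = i") (simp_all add: T'_T)
  qed
  moreover have "\<sigma> (\<tau> j) = j" for j
  proof -
    have "norm (T (T' (indicator {j})) j) = norm (indicator {j} (\<sigma> (\<tau> j)) :: 'k)"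
      by (simp add: \<sigma> \<tau> T'_mem)
    then show ?thesis by (cases "\<sigma> (\<tau> j) = j") (simp_all add: T_T')
  qed
  ultimately have bij: "bij \<sigma>" by (intro o_bij[of \<tau>]) (auto simp: fun_eq_iff)
  have iff: "s \<in> F \<longleftrightarrow> \<sigma> ` s \<in> G" if fin: "finite s" for s
  proof -
    have "family_norm G (indicator (\<sigma> ` s) :: 'b \<Rightarrow> 'k) = family_norm F (T' (indicator (\<sigma> ` s)))"
      by (simp add: T'_norm fin)
    also have "\<dots> = family_norm F (indicator s :: 'a \<Rightarrow> 'k)"
      unfolding family_norm_def
      by (simp add: \<sigma> fin indicator_def inj_image_mem_iff[OF bij_is_inj[OF bij]])
    finally have "family_norm G (indicator (\<sigma> ` s) :: 'b \<Rightarrow> 'k) = card (\<sigma> ` s)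
        \<longleftrightarrow> family_norm F (indicator s :: 'a \<Rightarrow> 'k) = card s"
      by (simp add: card_image[OF inj_on_subset[OF bij_is_inj[OF bij] subset_UNIV]])
    then show ?thesis
      using fin F.norm_indicator_mem G.norm_indicator_mem F.mem_if_norm_indicator
        G.mem_if_norm_indicator finite_imageI by metis
  qed
  have "G = {\<sigma> ` s | s. s \<in> F}"
  proof (intro equalityI subsetI)
    fix t assume t: "t \<in> G"
    let ?s = "inv \<sigma> ` t"
    have "t = \<sigma> ` ?s" by (simp add: image_comp surj_iff[THEN iffD1, OF bij_is_surj[OF bij]])
    moreover have "finite ?s" using G.finite_mem[OF t] by simp
    ultimately show "t \<in> {\<sigma> ` s | s. s \<in> F}" using iff[of ?s] t by auto
  qed (use iff F.finite_mem in auto)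
  then show ?thesis using bij by blast
qed

end

lemma isometric_imp_pi_homeomorphic:
  fixes F G :: "'a set set"
  assumes F: "compact_hereditary F" and G: "compact_hereditary G"
    and singletons: "\<And>i. {i} \<in> family_closure (maximal_sets F)"
      "\<And>i. {i} \<in> family_closure (maximal_sets G)"
    and iso: "isometric (fun_space F :: ('k::{real_normed_field,real_inner}, _) normed_space) (fun_space G)"
  shows "pi_homeomorphic F G"
proof -
  interpret F: compact_hereditary F by (rule F)
  interpret G: compact_hereditary G by (rule G)
  obtain T :: "('a \<Rightarrow> 'k) \<Rightarrow> 'a \<Rightarrow> 'k" where T: "bij_betw T (comb_funs F) (comb_funs G)"
    and add: "\<And>f g. f \<in> comb_funs F \<Longrightarrow> g \<in> comb_funs F \<Longrightarrow> T (\<lambda>i. f i + g i) = (\<lambda>i. T f i + T g i)"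
    and scale: "\<And>c f. f \<in> comb_funs F \<Longrightarrow> T (\<lambda>i. c * f i) = (\<lambda>i. c * T f i)"
    and norm: "\<And>f. f \<in> comb_funs F \<Longrightarrow> family_norm G (T f) = family_norm F f"
    using iso unfolding isometric_def fun_space_def by auto
  define T' where "T' = the_inv_into (comb_funs F) T"
  have inj: "inj_on T (comb_funs F)" and image: "T ` comb_funs F = comb_funs G"
    using T by (simp_all add: bij_betw_def)
  have T_mem: "T f \<in> comb_funs G" if "f \<in> comb_funs F" for f using image that by blast
  have T'_mem: "T' g \<in> comb_funs F" and T_T': "T (T' g) = g" if "g \<in> comb_funs G" for g
    using that the_inv_into_into[OF inj _ subset_refl] f_the_inv_into_f[OF inj]
    by (simp_all add: T'_def image)
  have T'_T: "T' (T f) = f" if "f \<in> comb_funs F" for f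
    using the_inv_into_f_f[OF inj that] by (simp add: T'_def)
  have "comb_isometry F G T T'"
  proof
    fix g g' :: "'a \<Rightarrow> 'k" and c
    assume g: "g \<in> comb_funs G"
    show "T' (\<lambda>j. c * g j) = (\<lambda>i. c * T' g i)"
      using T'_T[OF comb_funs_scale[OF T'_mem[OF g], of c]] by (simp add: scale T'_mem g T_T')
    show "family_norm F (T' g) = family_norm G g"
      using norm[OF T'_mem[OF g]] by (simp add: T_T' g)
    assume g': "g' \<in> comb_funs G"
    show "T' (\<lambda>j. g j + g' j) = (\<lambda>i. T' g i + T' g' i)"
      using T'_T[OF comb_funs_add[OF T'_mem[OF g] T'_mem[OF g']]]
      by (simp add: add T'_mem g g' T_T')
  qed (simp_all add: T_mem T'_mem T'_T T_T' add scale norm singletons)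
  then show ?thesis
    unfolding pi_homeomorphic_def by (rule comb_isometry.families_related_by_bijection)
qed

section \<open>Permutations induce isometries\<close>

lemma comb_funs_comp_inv:
  assumes "bij \<pi>" and f: "f \<in> comb_funs F"
  shows "f \<circ> inv \<pi> \<in> comb_funs ((`) \<pi> ` F)"
  unfolding comb_funs_def
proof (intro CollectI allI impI)
  fix e :: real assume "e > 0"
  then obtain x where x: "x \<in> c00" "\<forall>s\<in>F. (\<Sum>i\<in>s. norm (f i - x i)) \<le> e"
    using f unfolding comb_funs_def by blast
  have inj: "inj \<pi>" using \<open>bij \<pi>\<close> by (rule bij_is_inj)
  have "{i. (x \<circ> inv \<pi>) i \<noteq> 0} = \<pi> ` {i. x i \<noteq> 0}"
    using bij_image_Collect_eq[OF \<open>bij \<pi>\<close>] by simp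
  then have "x \<circ> inv \<pi> \<in> c00" using x(1) by (simp add: c00_def)
  moreover have "(\<Sum>i\<in>\<pi> ` s. norm ((f \<circ> inv \<pi>) i - (x \<circ> inv \<pi>) i)) = (\<Sum>i\<in>s. norm (f i - x i))" for s
    using inj by (simp add: sum.reindex inj_on_subset[OF inj subset_UNIV])
  ultimately show "\<exists>x\<in>c00. \<forall>s\<in>(`) \<pi> ` F. (\<Sum>i\<in>s. norm ((f \<circ> inv \<pi>) i - x i)) \<le> e"
    using x(2) by (intro bexI[of _ "x \<circ> inv \<pi>"]) auto
qed

lemma pi_homeomorphic_imp_isometric:
  fixes F G :: "'a set set"
  assumes "pi_homeomorphic F G"
  shows "isometric (fun_space F :: ('k::real_normed_field, _) normed_space) (fun_space G)"
proof -
  obtain \<pi> where bij: "bij \<pi>" and G: "G = (`) \<pi> ` F"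
    using assms unfolding pi_homeomorphic_def by (auto simp: Setcompr_eq_image)
  have inj: "inj \<pi>" using bij by (rule bij_is_inj)
  have F: "F = (`) (inv \<pi>) ` G"
    by (simp add: G image_comp comp_def inj)
  let ?T = "\<lambda>f :: 'a \<Rightarrow> 'k. f \<circ> inv \<pi>"
  let ?S = "\<lambda>f :: 'a \<Rightarrow> 'k. f \<circ> \<pi>"
  have S: "?S g \<in> comb_funs F" if "g \<in> comb_funs G" for g
    using comb_funs_comp_inv[OF bij_imp_bij_inv[OF bij] that] F by (simp add: inv_inv_eq[OF bij])
  have "bij_betw ?T (comb_funs F) (comb_funs G)"
  proof (rule bij_betwI[where g = ?S])
    show "?T \<in> comb_funs F \<rightarrow> comb_funs G"
      using comb_funs_comp_inv[OF bij] by (auto simp: G)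
    show "?S \<in> comb_funs G \<rightarrow> comb_funs F" using S by auto
    show "?S (?T f) = f" for f using inj by (simp add: comp_assoc)
    show "?T (?S g) = g" for g
      using bij by (simp add: comp_assoc surj_iff[THEN iffD1, OF bij_is_surj[OF bij]])
  qed
  moreover have "family_norm G (?T f) = family_norm F f" for f
    unfolding family_norm_def G image_image
    using inj by (simp add: sum.reindex inj_on_subset[OF inj subset_UNIV])
  ultimately show ?thesis
    unfolding isometric_def by (intro exI[of _ ?T]) (simp add: fun_space_def comp_def)
qed

lemma pi_homeomorphic_iff_isometric_comb_space:
  fixes F G :: "'a set set"
  assumes F: "compact_hereditary F" and G: "compact_hereditary G"
    and singletons: "\<And>i. {i} \<in> family_closure (maximal_sets F)"
      "\<And>i. {i} \<in> family_closure (maximal_sets G)"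
  shows "pi_homeomorphic F G \<longleftrightarrow>
    isometric (comb_space TYPE('k::{real_normed_field,real_inner,banach}) F) (comb_space TYPE('k) G)"
proof -
  have fam: "family F" "family G"
    using F G by (simp_all add: compact_hereditary_def set_family_def)
  show ?thesis
    unfolding isometric_comb_space_iff_fun_space[OF fam]
  proof
    assume "pi_homeomorphic F G"
    then show "isometric (fun_space F :: ('k, _) normed_space) (fun_space G)"
      by (rule pi_homeomorphic_imp_isometric)
  next
    assume "isometric (fun_space F :: ('k, _) normed_space) (fun_space G)"
    then show "pi_homeomorphic F G"
      by (rule isometric_imp_pi_homeomorphic[OF F G singletons])
  qed
qed

theorem corollary9:
  fixes F G :: "'a set set"
  assumes "infinite (UNIV :: 'a set)"
    and "family F" and "compact_family F" and "hereditary F"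
    and "family G" and "compact_family G" and "hereditary G"
    and "{s. card s = 1} \<subseteq> family_closure (maximal_sets F) \<inter> family_closure (maximal_sets G)"
  shows "(pi_homeomorphic F G \<longleftrightarrow> isometric (comb_space TYPE(real) F) (comb_space TYPE(real) G))
       \<and> (pi_homeomorphic F G \<longleftrightarrow> isometric (comb_space TYPE(complex) F) (comb_space TYPE(complex) G))"
proof -
  have F: "compact_hereditary F" and G: "compact_hereditary G"
    using assms by unfold_locales
  have singletons: "{i} \<in> family_closure (maximal_sets F)" "{i} \<in> family_closure (maximal_sets G)" for i
    using assms(8) by (auto simp: subset_eq)
  show ?thesis
    by (intro conjI pi_homeomorphic_iff_isometric_comb_space F G singletons)
qed

end
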